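(* Let $T>0$, let $\alpha\in(0,1)\cup(1,2)$ and let $B^{\mathcal H}_\alpha$ be the Hadamard fractional Brownian motion. The integral $$\int_0^Tf(s)\,dB^{\mathcal H}_\alpha(s)$$ exists as the almost sure limit of Riemann–Stieltjes sums if $f:[0,T]\to\mathbb R$ is Hölder continuous up to order $\beta$, where (i) $\beta>1-\frac\alpha2$ if $\alpha\in(0,1)$; (ii) $\beta>\frac12$ if $\alpha\in(1,2)$. Moreover, for any $\alpha\in(0,1)\cup(1,2)$ and any $f\in\mathcal C^{(1)}([0,T])$, the following integration-by-parts formula holds (almost surely): $$\int_0^Tf(s)\,dB^{\mathcal H}_\alpha(s)=f(T)B^{\mathcal H}_\alpha(T)-\int_0^TB^{\mathcal H}_\alpha(s)f'(s)\,ds.$$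
   Context: Let $B=\{B(t)\}_{t\ge0}$ be a standard Brownian motion. For $\alpha>0$ the Hadamard fractional Brownian motion is the centered Gaussian process $B^{\mathcal H}_\alpha=\{B^{\mathcal H}_\alpha(t)\}_{t\ge 0}$ given by $B^{\mathcal H}_\alpha(0)=0$ and the Wiener integral $$B^{\mathcal H}_\alpha(t)=\frac1{\sqrt{\Gamma(\alpha)}}\int_0^t\Big(\log\frac ts\Big)^{(\alpha-1)/2}dB(s),\qquad t>0;$$ a continuous modification is used. "Hölder continuous up to order $\beta$" means Hölder continuous of every order $\beta'\in(0,\beta)$. Riemann–Stieltjes sums are $\sum_k f(\xi_k)\big(B^{\mathcal H}_\alpha(t_{k})-B^{\mathcal H}_\alpha(t_{k-1})\big)$ over partitions $0=t_0<\dots<t_n=T$ with $\xi_k\in[t_{k-1},t_k]$, and the limit is taken as the mesh of the partition tends to $0$. $\mathcal C^{(1)}([0,T])$ is the space of continuously differentiable functions. *)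

theory Defs
  imports "HOL-Probability.Probability"
begin

section \<open>Brownian motion and the Wiener integral\<close>

text \<open>Processes are families \<open>X t\<close> of real random variables; only times \<open>t \<ge> 0\<close> matter.
  The second argument of \<^const>\<open>normal_density\<close> is the standard deviation, not the variance.\<close>

definition standard_brownian_motion :: "'a measure \<Rightarrow> (real \<Rightarrow> 'a \<Rightarrow> real) \<Rightarrow> bool" where
  "standard_brownian_motion M B \<longleftrightarrow>
     prob_space M \<and>
     (\<forall>t\<ge>0. B t \<in> borel_measurable M) \<and>
     (AE \<omega> in M. B 0 \<omega> = 0) \<and>
     (\<forall>n (t :: nat \<Rightarrow> real). 0 \<le> t 0 \<and> (\<forall>k<n. t k < t (Suc k)) \<longrightarrow>
        prob_space.indep_vars M (\<lambda>_. borel) (\<lambda>k \<omega>. B (t (Suc k)) \<omega> - B (t k) \<omega>) {..<n}) \<and>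
     (\<forall>s t. 0 \<le> s \<and> s < t \<longrightarrow>
        distributed M lborel (\<lambda>\<omega>. B t \<omega> - B s \<omega>) (normal_density 0 (sqrt (t - s)))) \<and>
     (AE \<omega> in M. continuous_on {0..} (\<lambda>t. B t \<omega>))"

text \<open>A step function on \<open>[0,\<infinity>)\<close> has value \<open>c k\<close> on \<open>(p k, p (k + 1)]\<close> for \<open>k < n\<close>
  and vanishes elsewhere.\<close>

definition step_nodes :: "nat \<Rightarrow> (nat \<Rightarrow> real) \<Rightarrow> bool" where
  "step_nodes n p \<longleftrightarrow> 0 \<le> p 0 \<and> (\<forall>k<n. p k < p (Suc k))"

definition step_fun :: "nat \<Rightarrow> (nat \<Rightarrow> real) \<Rightarrow> (nat \<Rightarrow> real) \<Rightarrow> real \<Rightarrow> real" where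
  "step_fun n p c s = (\<Sum>k<n. c k * indicator {p k<..p (Suc k)} s)"

definition step_wiener_integral ::
  "(real \<Rightarrow> 'a \<Rightarrow> real) \<Rightarrow> nat \<Rightarrow> (nat \<Rightarrow> real) \<Rightarrow> (nat \<Rightarrow> real) \<Rightarrow> 'a \<Rightarrow> real" where
  "step_wiener_integral B n p c \<omega> = (\<Sum>k<n. c k * (B (p (Suc k)) \<omega> - B (p k) \<omega>))"

text \<open>\<open>X\<close> is (a version of) \<open>\<integral>\<^sub>A h dB\<close>, for \<open>A \<subseteq> [0,\<infinity>)\<close>: step functions converge to
  \<open>h 1\<^sub>A\<close> in \<open>L\<^sup>2\<close> of Lebesgue measure while their Wiener integrals converge to \<open>X\<close> in
  \<open>L\<^sup>2(M)\<close>.  With the non-negative integral, convergence to \<open>0\<close> also forces \<open>h 1\<^sub>A\<close> and \<open>X\<close> to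
  be square integrable.  By the Wiener isometry \<open>X\<close> is determined almost surely.\<close>

definition has_wiener_integral ::
  "'a measure \<Rightarrow> (real \<Rightarrow> 'a \<Rightarrow> real) \<Rightarrow> real set \<Rightarrow> (real \<Rightarrow> real) \<Rightarrow> ('a \<Rightarrow> real) \<Rightarrow> bool" where
  "has_wiener_integral M B A h X \<longleftrightarrow>
     (\<lambda>s. indicator A s * h s) \<in> borel_measurable lborel \<and>
     X \<in> borel_measurable M \<and>
     (\<exists>n p c. (\<forall>i. step_nodes (n i) (p i)) \<and>
        (\<lambda>i::nat. \<integral>\<^sup>+ s. ennreal ((step_fun (n i) (p i) (c i) s - indicator A s * h s)\<^sup>2) \<partial>lborel)
          \<longlonglongrightarrow> 0 \<and>
        (\<lambda>i. \<integral>\<^sup>+ \<omega>. ennreal ((step_wiener_integral B (n i) (p i) (c i) \<omega> - X \<omega>)\<^sup>2) \<partial>M)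
          \<longlonglongrightarrow> 0)"

section \<open>Hadamard fractional Brownian motion\<close>

text \<open>Being built from Wiener integrals, \<open>H\<close> is specified only up to modification; path
  continuity is a separate requirement.\<close>

definition hadamard_fbm ::
  "'a measure \<Rightarrow> (real \<Rightarrow> 'a \<Rightarrow> real) \<Rightarrow> real \<Rightarrow> (real \<Rightarrow> 'a \<Rightarrow> real) \<Rightarrow> bool" where
  "hadamard_fbm M B \<alpha> H \<longleftrightarrow>
     (\<forall>t\<ge>0. H t \<in> borel_measurable M) \<and>
     (AE \<omega> in M. H 0 \<omega> = 0) \<and>
     (\<forall>t>0. \<exists>W. has_wiener_integral M B {0<..<t} (\<lambda>s. ln (t / s) powr ((\<alpha> - 1) / 2)) W \<and>
        (AE \<omega> in M. H t \<omega> = 1 / sqrt (Gamma \<alpha>) * W \<omega>))"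

definition continuous_paths :: "'a measure \<Rightarrow> (real \<Rightarrow> 'a \<Rightarrow> real) \<Rightarrow> bool" where
  "continuous_paths M X \<longleftrightarrow> (AE \<omega> in M. continuous_on {0..} (\<lambda>t. X t \<omega>))"

section \<open>Hoelder continuity, continuous differentiability and Riemann-Stieltjes integrals\<close>

definition holder_continuous_on :: "real set \<Rightarrow> real \<Rightarrow> (real \<Rightarrow> real) \<Rightarrow> bool" where
  "holder_continuous_on S \<gamma> f \<longleftrightarrow>
     (\<exists>C. \<forall>s\<in>S. \<forall>t\<in>S. \<bar>f s - f t\<bar> \<le> C * \<bar>s - t\<bar> powr \<gamma>)"

definition holder_continuous_up_to :: "real set \<Rightarrow> real \<Rightarrow> (real \<Rightarrow> real) \<Rightarrow> bool" where
  "holder_continuous_up_to S \<beta> f \<longleftrightarrow> (\<forall>\<gamma>. 0 < \<gamma> \<and> \<gamma> < \<beta> \<longrightarrow> holder_continuous_on S \<gamma> f)"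

text \<open>\<open>f \<in> C\<^sup>1([a,b])\<close> with derivative \<open>f'\<close>; derivatives at the end points are one-sided, which
  is why the library's \<open>C1_differentiable_on\<close> is not used.\<close>

definition C1_on_with_deriv :: "real \<Rightarrow> real \<Rightarrow> (real \<Rightarrow> real) \<Rightarrow> (real \<Rightarrow> real) \<Rightarrow> bool" where
  "C1_on_with_deriv a b f f' \<longleftrightarrow>
     (\<forall>x\<in>{a..b}. (f has_real_derivative f' x) (at x within {a..b})) \<and> continuous_on {a..b} f'"

definition tagged_partition ::
  "real \<Rightarrow> real \<Rightarrow> nat \<Rightarrow> (nat \<Rightarrow> real) \<Rightarrow> (nat \<Rightarrow> real) \<Rightarrow> bool" where
  "tagged_partition a b n t \<xi> \<longleftrightarrow>
     t 0 = a \<and> t n = b \<and> (\<forall>k\<in>{1..n}. t (k - 1) < t k \<and> \<xi> k \<in> {t (k - 1)..t k})"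

definition riemann_stieltjes_sum ::
  "(real \<Rightarrow> real) \<Rightarrow> (real \<Rightarrow> real) \<Rightarrow> nat \<Rightarrow> (nat \<Rightarrow> real) \<Rightarrow> (nat \<Rightarrow> real) \<Rightarrow> real" where
  "riemann_stieltjes_sum f g n t \<xi> = (\<Sum>k=1..n. f (\<xi> k) * (g (t k) - g (t (k - 1))))"

text \<open>\<open>I\<close> is the limit of the Riemann-Stieltjes sums of \<open>f\<close> against \<open>g\<close> over all tagged partitions
  of \<open>[a,b]\<close> as the mesh tends to \<open>0\<close>.\<close>

definition has_rs_integral ::
  "(real \<Rightarrow> real) \<Rightarrow> (real \<Rightarrow> real) \<Rightarrow> real \<Rightarrow> real \<Rightarrow> real \<Rightarrow> bool" where
  "has_rs_integral f g a b I \<longleftrightarrow>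
     (\<forall>\<epsilon>>0. \<exists>\<delta>>0. \<forall>n t \<xi>. tagged_partition a b n t \<xi> \<and> (\<forall>k\<in>{1..n}. t k - t (k - 1) < \<delta>) \<longrightarrow>
        \<bar>riemann_stieltjes_sum f g n t \<xi> - I\<bar> < \<epsilon>)"

lemma has_rs_integral_unique:
  assumes "a < b" "has_rs_integral f g a b I" "has_rs_integral f g a b J"
  shows "I = J"
proof (rule ccontr)
  assume "I \<noteq> J"
  define e where "e = \<bar>I - J\<bar> / 2"
  have e: "e > 0" using \<open>I \<noteq> J\<close> by (simp add: e_def)
  obtain d1 where d1: "d1 > 0" "\<And>n t \<xi>. tagged_partition a b n t \<xi> \<Longrightarrow>
      \<forall>k\<in>{1..n}. t k - t (k - 1) < d1 \<Longrightarrow> \<bar>riemann_stieltjes_sum f g n t \<xi> - I\<bar> < e"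
    using assms(2) e unfolding has_rs_integral_def by meson
  obtain d2 where d2: "d2 > 0" "\<And>n t \<xi>. tagged_partition a b n t \<xi> \<Longrightarrow>
      \<forall>k\<in>{1..n}. t k - t (k - 1) < d2 \<Longrightarrow> \<bar>riemann_stieltjes_sum f g n t \<xi> - J\<bar> < e"
    using assms(3) e unfolding has_rs_integral_def by meson
  define d where "d = min d1 d2"
  have d: "d > 0" using d1 d2 by (simp add: d_def)
  obtain n :: nat where n: "(b - a) / d < real n" using reals_Archimedean2 by blast
  have "0 < (b - a) / d" using assms(1) d by simp
  with n have n0: "real n > 0" by linarith
  define t where "t k = a + real k * ((b - a) / real n)" for k
  have diff: "t k - t (k - 1) = (b - a) / real n" if "k \<in> {1..n}" for k
    using that by (simp add: t_def of_nat_diff left_diff_distrib diff_divide_distrib)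
  have h: "0 < (b - a) / real n" "(b - a) / real n < d"
    using assms(1) n0 n d by (simp_all add: field_simps)
  have "tagged_partition a b n t t"
    unfolding tagged_partition_def
  proof (intro conjI ballI)
    show "t 0 = a" "t n = b" using n0 by (simp_all add: t_def)
    fix k assume "k \<in> {1..n}"
    from diff[OF this] h(1) show "t (k - 1) < t k" "t k \<in> {t (k - 1)..t k}" by auto
  qed
  moreover have "\<forall>k\<in>{1..n}. t k - t (k - 1) < d1" "\<forall>k\<in>{1..n}. t k - t (k - 1) < d2"
    using diff h(2) by (auto simp: d_def)
  ultimately have "\<bar>riemann_stieltjes_sum f g n t t - I\<bar> < e"
    "\<bar>riemann_stieltjes_sum f g n t t - J\<bar> < e"
    using d1(2) d2(2) by blast+
  moreover have "\<bar>I - J\<bar> = 2 * e" by (simp add: e_def)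
  ultimately show False by linarith
qed

end

theory Submission
  imports Defs
begin

text \<open>
  Once almost every path of \<open>H\<close> is known to be Hoelder continuous of every order below
  \<open>min \<alpha> 1 / 2\<close> on \<open>{0..T}\<close>, the theorem is a pathwise statement: the conditions on \<open>\<beta>\<close> say that
  \<open>\<beta> + min \<alpha> 1 / 2 > 1\<close>, which is the condition of Young for the Riemann-Stieltjes integral of one
  Hoelder function against another.

  Path regularity.  The kernel of \<open>H\<close> scales, so its squared norm is \<open>c t\<close>, and it is monotone in \<open>t\<close>;
  from these two facts the increment \<open>H t - H s\<close> has variance at most a multiple of
  \<open>\<bar>t - s\<bar> powr min \<alpha> 1\<close> (\<open>hadamard_kernel_increment\<close>).  The exponent is \<open>1\<close> rather than \<open>\<alpha>\<close> for
  \<open>\<alpha> > 1\<close> because of the behaviour at the origin, where by scaling \<open>H t\<close> has a variance proportional to \<open>t\<close>.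
  Step integrals are Gaussian, so all even moments are controlled by the variance, also in the limit
  (\<open>wiener_integral_increment_moment\<close>).  Moments of high order and Kolmogorov's chaining argument
  (\<open>kolmogorov_dyadic_holder\<close>) give Hoelder continuity of the paths (\<open>hadamard_fbm_holder_paths\<close>).

  The pathwise integral.  For a continuously differentiable integrand and a continuous integrator the
  integral exists and is given by parts (\<open>rs_integral_by_parts\<close>); as \<open>H 0 = 0\<close> almost surely this is
  the asserted formula.  For a Hoelder integrand \<open>f\<close>, moving averages are
  continuously differentiable and converge to \<open>f\<close> in slightly weaker Hoelder norms, and Young's
  inequality (\<open>rs_sum_holder_bound\<close>) makes the Riemann-Stieltjes sums of \<open>f\<close> and of its averages close
  uniformly over all partitions (\<open>young_rs_integrable\<close>).
\<close>

section \<open>Riemann-Stieltjes integrals of smooth integrands\<close>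

lemma tagged_partition_mono:
  assumes "tagged_partition a b n t \<xi>" "i \<le> j" "j \<le> n"
  shows "t i \<le> t j"
  using assms(2,3)
proof (induction j rule: dec_induct)
  case (step m)
  have "t (Suc m - 1) < t (Suc m)"
    using assms(1) step unfolding tagged_partition_def by (metis atLeastAtMost_iff le_add1 plus_1_eq_Suc)
  then show ?case using step by simp
qed simp

text \<open>If \<open>f \<xi> (g d - g c)\<close> agrees with the increment of \<open>\<Phi>\<close> up to \<open>o(d - c)\<close>, uniformly in the
  interval and in the tag, then the increments of \<open>\<Phi>\<close> telescope over a partition and the errors add
  up to at most \<open>\<epsilon> (b - a)\<close>.\<close>

lemma rs_integralI_local:
  fixes f g \<Phi> :: "real \<Rightarrow> real"
  assumes "a < b"
    and loc: "\<And>\<epsilon>. \<epsilon> > 0 \<Longrightarrow> \<exists>\<delta>>0. \<forall>c d \<xi>. a \<le> c \<and> c < d \<and> d \<le> b \<and> d - c < \<delta> \<and> \<xi> \<in> {c..d} \<longrightarrow>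
       \<bar>f \<xi> * (g d - g c) - (\<Phi> d - \<Phi> c)\<bar> \<le> \<epsilon> * (d - c)"
  shows "has_rs_integral f g a b (\<Phi> b - \<Phi> a)"
  unfolding has_rs_integral_def
proof (intro allI impI)
  fix e :: real assume e: "e > 0"
  define e' where "e' = e / (2 * (b - a))"
  have e': "e' > 0" "e' * (b - a) < e" using e \<open>a < b\<close> by (auto simp: e'_def field_simps)
  obtain \<delta> where \<delta>: "\<delta> > 0" and L: "\<And>c d \<xi>. a \<le> c \<Longrightarrow> c < d \<Longrightarrow> d \<le> b \<Longrightarrow> d - c < \<delta> \<Longrightarrow> \<xi> \<in> {c..d} \<Longrightarrow>
       \<bar>f \<xi> * (g d - g c) - (\<Phi> d - \<Phi> c)\<bar> \<le> e' * (d - c)"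
    using loc[OF e'(1)] by auto
  show "\<exists>\<delta>>0. \<forall>n t \<xi>. tagged_partition a b n t \<xi> \<and> (\<forall>k\<in>{1..n}. t k - t (k - 1) < \<delta>) \<longrightarrow>
        \<bar>riemann_stieltjes_sum f g n t \<xi> - (\<Phi> b - \<Phi> a)\<bar> < e"
  proof (intro exI[of _ \<delta>] conjI allI impI \<delta>)
    fix n t \<xi> assume A: "tagged_partition a b n t \<xi> \<and> (\<forall>k\<in>{1..n}. t k - t (k - 1) < \<delta>)"
    have t0: "t 0 = a" "t n = b" and step: "\<And>k. k \<in> {1..n} \<Longrightarrow> t (k-1) < t k \<and> \<xi> k \<in> {t (k - 1)..t k}"
      using A by (auto simp: tagged_partition_def)
    have mono: "t i \<le> t j" if "i \<le> j" "j \<le> n" for i j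
      using tagged_partition_mono[of a b n t \<xi>] A that by blast
    have tele: "(\<Sum>k=1..n. h (t k) - h (t (k-1))) = h b - h a" for h :: "real \<Rightarrow> real"
      using sum_telescope''[of 0 n "\<lambda>k. h (t k)"] t0 by (simp add: atLeastSucAtMost_greaterThanAtMost[symmetric])
    have "\<bar>riemann_stieltjes_sum f g n t \<xi> - (\<Phi> b - \<Phi> a)\<bar>
       = \<bar>\<Sum>k=1..n. f (\<xi> k) * (g (t k) - g (t (k-1))) - (\<Phi> (t k) - \<Phi> (t (k-1)))\<bar>"
      unfolding riemann_stieltjes_sum_def sum_subtractf[of "\<lambda>k. f (\<xi> k) * _ k"] tele[of \<Phi>] by simp
    also have "\<dots> \<le> (\<Sum>k=1..n. e' * (t k - t (k-1)))"
    proof (rule order_trans[OF sum_abs], rule sum_mono)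
      fix k assume k: "k \<in> {1..n}"
      show "\<bar>f (\<xi> k) * (g (t k) - g (t (k-1))) - (\<Phi> (t k) - \<Phi> (t (k-1)))\<bar> \<le> e' * (t k - t (k-1))"
        using A k step[OF k] mono[of 0 "k-1"] mono[of k n] t0 by (intro L) auto
    qed
    also have "\<dots> = e' * (b - a)" using tele[of "\<lambda>x. x"] by (simp add: sum_distrib_left[symmetric])
    finally show "\<bar>riemann_stieltjes_sum f g n t \<xi> - (\<Phi> b - \<Phi> a)\<bar> < e" using e' by simp
  qed
qed

lemma integral_mult_deriv_approx:
  fixes f f' g :: "real \<Rightarrow> real"
  assumes "c \<le> d" "\<And>x. x \<in> {c..d} \<Longrightarrow> (f has_real_derivative f' x) (at x within {c..d})"
    and "continuous_on {c..d} f'" "continuous_on {c..d} g"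
    and "\<And>x. x \<in> {c..d} \<Longrightarrow> \<bar>f' x\<bar> \<le> K" "\<And>x. x \<in> {c..d} \<Longrightarrow> \<bar>g x - y\<bar> \<le> \<eta>"
  shows "\<bar>integral {c..d} (\<lambda>s. g s * f' s) - y * (f d - f c)\<bar> \<le> \<eta> * K * (d - c)"
proof -
  have 1: "(f' has_integral (f d - f c)) {c..d}"
    using assms(1,2) by (intro fundamental_theorem_of_calculus) (auto simp: has_real_derivative_iff_has_vector_derivative)
  have 2: "((\<lambda>s. g s * f' s) has_integral integral {c..d} (\<lambda>s. g s * f' s)) {c..d}"
    using assms by (intro integrable_integral integrable_continuous_real continuous_intros) auto
  have 3: "((\<lambda>s. g s * f' s - y * f' s) has_integral (integral {c..d} (\<lambda>s. g s * f' s) - y * (f d - f c))) {c..d}"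
    by (intro has_integral_diff 2 has_integral_mult_right 1)
  have pos: "0 \<le> \<eta>" "0 \<le> K" using assms(5)[of c] assms(6)[of c] assms(1) by auto
  have "norm (integral {c..d} (\<lambda>s. g s * f' s) - y * (f d - f c)) \<le> (\<eta> * K) * measure lborel {c..d}"
  proof (rule has_integral_bound_real[OF _ finite.emptyI 3])
    show "norm (g x * f' x - y * f' x) \<le> \<eta> * K" if "x \<in> {c..d} - {}" for x
      using mult_mono[OF assms(6)[of x] assms(5)[of x]] that pos
      by (auto simp: abs_mult[symmetric] left_diff_distrib)
  qed (use pos in auto)
  then show ?thesis using assms(1) by simp
qed

text \<open>The candidate for \<open>\<Phi>\<close> is \<open>f g - \<integral> g f'\<close>.  On \<open>{c..d}\<close> with tag \<open>\<xi>\<close> the Riemann-Stieltjes term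
  differs from the increment of \<open>\<Phi>\<close> by \<open>\<integral> (g - g c) f'\<close> over \<open>{c..\<xi>}\<close> plus \<open>\<integral> (g - g d) f'\<close> over
  \<open>{\<xi>..d}\<close>, and both are small by uniform continuity of \<open>g\<close>; hence mere continuity of the integrator
  suffices when the integrand is continuously differentiable.\<close>

lemma rs_integral_by_parts:
  fixes f f' g :: "real \<Rightarrow> real"
  assumes "a < b" and C1: "C1_on_with_deriv a b f f'" and g: "continuous_on {a..b} g"
  shows "has_rs_integral f g a b (f b * g b - f a * g a - integral {a..b} (\<lambda>s. g s * f' s))"
proof -
  define G where "G = (\<lambda>s. g s * f' s)"
  define \<Phi> where "\<Phi> = (\<lambda>x. f x * g x - integral {a..x} G)"
  have f': "continuous_on {a..b} f'" and df: "\<And>x. x \<in> {a..b} \<Longrightarrow> (f has_real_derivative f' x) (at x within {a..b})"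
    using C1 by (auto simp: C1_on_with_deriv_def)
  have cG: "continuous_on {a..b} G" unfolding G_def by (intro continuous_intros g f')
  obtain K where K: "K > 0" "\<And>x. x \<in> {a..b} \<Longrightarrow> \<bar>f' x\<bar> \<le> K"
    using compact_imp_bounded[OF compact_continuous_image[OF f' compact_Icc]]
    by (auto simp: bounded_pos)
  have ug: "uniformly_continuous_on {a..b} g" using g compact_uniformly_continuous by blast
  have "has_rs_integral f g a b (\<Phi> b - \<Phi> a)"
  proof (rule rs_integralI_local[OF \<open>a < b\<close>])
    fix e :: real assume e: "e > 0"
    define \<eta> where "\<eta> = e / K"
    have \<eta>: "\<eta> > 0" "\<eta> * K = e" using e K by (auto simp: \<eta>_def)
    obtain \<delta> where \<delta>: "\<delta> > 0" and u: "\<And>x y. x \<in> {a..b} \<Longrightarrow> y \<in> {a..b} \<Longrightarrow> \<bar>x - y\<bar> < \<delta> \<Longrightarrow> \<bar>g x - g y\<bar> < \<eta>"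
      using ug \<eta>(1) unfolding uniformly_continuous_on_def dist_real_def by metis
    show "\<exists>\<delta>>0. \<forall>c d \<xi>. a \<le> c \<and> c < d \<and> d \<le> b \<and> d - c < \<delta> \<and> \<xi> \<in> {c..d} \<longrightarrow>
       \<bar>f \<xi> * (g d - g c) - (\<Phi> d - \<Phi> c)\<bar> \<le> e * (d - c)"
    proof (intro exI[of _ \<delta>] conjI allI impI \<delta>)
      fix c d \<xi> assume A: "a \<le> c \<and> c < d \<and> d \<le> b \<and> d - c < \<delta> \<and> \<xi> \<in> {c..d}"
      have est: "\<bar>integral {p..q} G - g y * (f q - f p)\<bar> \<le> e * (q - p)"
        if "c \<le> p" "p \<le> q" "q \<le> d" "y \<in> {c..d}" for p q y
        unfolding G_def \<eta>(2)[symmetric]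
      proof (rule integral_mult_deriv_approx)
        show "(f has_real_derivative f' x) (at x within {p..q})" if "x \<in> {p..q}" for x
          using df[of x] that \<open>c \<le> p\<close> \<open>q \<le> d\<close> A by (rule_tac DERIV_subset[of _ _ _ "{a..b}"]) auto
        show "continuous_on {p..q} f'" "continuous_on {p..q} g"
          using that A f' g by (auto intro: continuous_on_subset)
        show "\<bar>f' x\<bar> \<le> K" if "x \<in> {p..q}" for x using K(2)[of x] that \<open>c \<le> p\<close> \<open>q \<le> d\<close> A by auto
        show "\<bar>g x - g y\<bar> \<le> \<eta>" if "x \<in> {p..q}" for x
          using u[of x y] that \<open>c \<le> p\<close> \<open>q \<le> d\<close> A \<open>y \<in> {c..d}\<close>
          by (intro less_imp_le) auto
      qed fact
      have int: "G integrable_on {p..q}" if "a \<le> p" "q \<le> b" for p q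
        by (rule integrable_continuous_real, rule continuous_on_subset[OF cG]) (use that in auto)
      have "integral {a..d} G = integral {a..c} G + integral {c..d} G"
        using A by (intro Henstock_Kurzweil_Integration.integral_combine[symmetric] int) auto
      moreover have "integral {c..d} G = integral {c..\<xi>} G + integral {\<xi>..d} G"
        using A by (intro Henstock_Kurzweil_Integration.integral_combine[symmetric] int) auto
      ultimately have "f \<xi> * (g d - g c) - (\<Phi> d - \<Phi> c)
          = (integral {c..\<xi>} G - g c * (f \<xi> - f c)) + (integral {\<xi>..d} G - g d * (f d - f \<xi>))"
        by (simp add: \<Phi>_def algebra_simps)
      moreover have "\<bar>integral {c..\<xi>} G - g c * (f \<xi> - f c)\<bar> \<le> e * (\<xi> - c)"
         "\<bar>integral {\<xi>..d} G - g d * (f d - f \<xi>)\<bar> \<le> e * (d - \<xi>)"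
        using A by (intro est; auto)+
      ultimately show "\<bar>f \<xi> * (g d - g c) - (\<Phi> d - \<Phi> c)\<bar> \<le> e * (d - c)"
        by (simp add: algebra_simps)
    qed
  qed
  then show ?thesis by (simp add: \<Phi>_def G_def algebra_simps)
qed

section \<open>Young's inequality for Riemann-Stieltjes sums\<close>

text \<open>The bound does not depend on the number of nodes.  Cut the partition at the node interval that
  contains the midpoint: the two outer pieces are at most half as long, so by induction each
  contributes \<open>2 powr (-\<theta>)\<close> times the bound for the whole, \<open>\<theta> = \<beta> + \<gamma>\<close>, and the cross terms cost at
  most \<open>2 K L (t j - t i) powr \<theta>\<close>.  As \<open>\<theta> > 1\<close> the two halves together contribute a factor
  \<open>2 powr (1 - \<theta>) < 1\<close>, and the constant below is the fixed point of this recursion.\<close>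

lemma young_loeve_bound:
  fixes f g :: "real \<Rightarrow> real" and t :: "nat \<Rightarrow> real"
  assumes f: "\<And>x y. x \<in> S \<Longrightarrow> y \<in> S \<Longrightarrow> \<bar>f x - f y\<bar> \<le> K * \<bar>x - y\<bar> powr \<beta>"
    and g: "\<And>x y. x \<in> S \<Longrightarrow> y \<in> S \<Longrightarrow> \<bar>g x - g y\<bar> \<le> L * \<bar>x - y\<bar> powr \<gamma>"
    and pos: "K \<ge> 0" "L \<ge> 0" "\<beta> > 0" "\<gamma> > 0" and \<theta>: "\<beta> + \<gamma> > 1"
    and mono: "\<And>i j. i \<le> j \<Longrightarrow> j \<le> n \<Longrightarrow> t i \<le> t j" and S: "\<And>i. i \<le> n \<Longrightarrow> t i \<in> S"
    and ij: "i \<le> j" "j \<le> n"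
  shows "\<bar>(\<Sum>k=i..<j. f (t k) * (g (t (Suc k)) - g (t k))) - f (t i) * (g (t j) - g (t i))\<bar>
    \<le> 2 / (1 - 2 powr (1 - (\<beta> + \<gamma>))) * K * L * (t j - t i) powr (\<beta> + \<gamma>)"
  using ij
proof (induction "j - i" arbitrary: i j rule: less_induct)
  case less
  define \<theta> where "\<theta> = \<beta> + \<gamma>"
  define C where "C = 2 / (1 - 2 powr (1 - \<theta>))"
  have q: "2 powr (1 - \<theta>) < 1" using \<theta> by (simp add: \<theta>_def powr_less_one)
  have C: "C \<ge> 0" "C * 2 powr (1 - \<theta>) + 2 = C"
    using q by (simp_all add: C_def divide_simps) (auto simp: algebra_simps)
  define R where "R i j = (\<Sum>k=i..<j. f (t k) * (g (t (Suc k)) - g (t k))) - f (t i) * (g (t j) - g (t i))" for i j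
  show ?case
  proof (cases "i = j")
    case True then show ?thesis by simp
  next
    case False
    define D where "D = t j - t i"
    have D: "D \<ge> 0" using mono[of i j] less by (simp add: D_def)
    define A where "A = {k \<in> {i..<j}. t k \<le> (t i + t j) / 2}"
    have A: "finite A" "i \<in> A" using False less D by (auto simp: A_def D_def)
    \<comment> \<open>the last node not beyond the midpoint\<close>
    define l where "l = Max A"
    have "l \<in> A" unfolding l_def using A by (intro Max_in) auto
    then have l: "i \<le> l" "l < j" "t l \<le> (t i + t j) / 2" by (auto simp: A_def)
    have l': "t (Suc l) \<ge> (t i + t j) / 2"
    proof (cases "Suc l = j")
      case True then show ?thesis using D by (simp add: D_def field_simps)
    next
      case False
      have "Suc l \<notin> A" using Max_ge[OF A(1), of "Suc l"] unfolding l_def by linarith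
      then show ?thesis using False l by (auto simp: A_def)
    qed
    have half: "2 * (C * K * L * (D / 2) powr \<theta>) = C * 2 powr (1 - \<theta>) * K * L * D powr \<theta>"
      using D by (simp add: powr_divide powr_diff)
    have small: "C * K * L * x powr \<theta> \<le> C * K * L * (D / 2) powr \<theta>" if "0 \<le> x" "x \<le> D / 2" for x
      using that C pos \<theta> by (intro mult_left_mono powr_mono2 mult_nonneg_nonneg) (auto simp: \<theta>_def)
    have 1: "\<bar>R i l\<bar> \<le> C * K * L * (D / 2) powr \<theta>"
      unfolding R_def
      by (rule order_trans[OF less.hyps[of l i, folded \<theta>_def, folded C_def] small])
        (use l less mono[of i l] in \<open>auto simp: D_def field_simps\<close>)
    have 2: "\<bar>R (Suc l) j\<bar> \<le> C * K * L * (D / 2) powr \<theta>"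
      unfolding R_def
      by (rule order_trans[OF less.hyps[of j "Suc l", folded \<theta>_def, folded C_def] small])
        (use l l' less mono[of "Suc l" j] in \<open>auto simp: D_def field_simps\<close>)
    have cross: "\<bar>(f (t p) - f (t i)) * (g (t q) - g (t r))\<bar> \<le> K * L * D powr \<theta>"
      if "i \<le> p" "p \<le> j" "i \<le> r" "r \<le> q" "q \<le> j" for p q r
    proof -
      have "\<bar>f (t p) - f (t i)\<bar> \<le> K * D powr \<beta>"
        by (rule order_trans[OF f mult_left_mono[OF powr_mono2]])
          (use that less mono[of i p] mono[of p j] S pos in \<open>auto simp: D_def\<close>)
      moreover have "\<bar>g (t q) - g (t r)\<bar> \<le> L * D powr \<gamma>"
        by (rule order_trans[OF g mult_left_mono[OF powr_mono2]])
          (use that less mono[of r q] mono[of i r] mono[of q j] S pos in \<open>auto simp: D_def\<close>)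
      ultimately have "\<bar>f (t p) - f (t i)\<bar> * \<bar>g (t q) - g (t r)\<bar> \<le> (K * D powr \<beta>) * (L * D powr \<gamma>)"
        using pos by (intro mult_mono) auto
      then show ?thesis by (simp add: abs_mult \<theta>_def powr_add mult_ac)
    qed
    have split: "(\<Sum>k=i..<j. h k) = (\<Sum>k=i..<l. h k) + h l + (\<Sum>k=Suc l..<j. h k)" for h :: "nat \<Rightarrow> real"
      using l sum.atLeastLessThan_concat[of i l j h] by (simp add: sum.atLeast_Suc_lessThan)
    have "R i j = R i l + R (Suc l) j + (f (t l) - f (t i)) * (g (t (Suc l)) - g (t l))
        + (f (t (Suc l)) - f (t i)) * (g (t j) - g (t (Suc l)))"
      unfolding R_def split by (simp add: algebra_simps)
    then have "\<bar>R i j\<bar> \<le> 2 * (C * K * L * (D / 2) powr \<theta>) + 2 * (K * L * D powr \<theta>)"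
      using 1 2 cross[of l l "Suc l"] cross[of "Suc l" "Suc l" j] l by linarith
    also have "\<dots> = (C * 2 powr (1 - \<theta>) + 2) * K * L * D powr \<theta>"
      unfolding half by (simp add: algebra_simps)
    finally show ?thesis unfolding C(2) by (simp add: R_def C_def D_def \<theta>_def)
  qed
qed

text \<open>Moving the tags to the left end points changes the sum by at most
  \<open>K L \<Sum> (t (k+1) - t k) powr \<theta>\<close>, which is at most \<open>K L (b - a) powr \<theta>\<close>; the left-point sum is then
  compared with \<open>f a (g b - g a)\<close>.  The bound is linear in \<open>\<bar>f a\<bar>\<close> and in the Hoelder constant of
  \<open>f\<close>, so that integrands close in Hoelder norm have close sums on every partition at once.\<close>

lemma rs_sum_holder_bound:
  fixes f g :: "real \<Rightarrow> real"
  assumes f: "\<And>x y. x \<in> {a..b} \<Longrightarrow> y \<in> {a..b} \<Longrightarrow> \<bar>f x - f y\<bar> \<le> K * \<bar>x - y\<bar> powr \<beta>"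
    and g: "\<And>x y. x \<in> {a..b} \<Longrightarrow> y \<in> {a..b} \<Longrightarrow> \<bar>g x - g y\<bar> \<le> L * \<bar>x - y\<bar> powr \<gamma>"
    and pos: "K \<ge> 0" "L \<ge> 0" "\<beta> > 0" "\<gamma> > 0" and \<theta>: "\<beta> + \<gamma> > 1"
    and P: "tagged_partition a b n t \<xi>"
  shows "\<bar>riemann_stieltjes_sum f g n t \<xi>\<bar> \<le> \<bar>f a\<bar> * \<bar>g b - g a\<bar>
    + (2 / (1 - 2 powr (1 - (\<beta> + \<gamma>))) + 1) * K * L * (b - a) powr (\<beta> + \<gamma>)"
proof -
  note mono = tagged_partition_mono[OF P]
  have ends: "t 0 = a" "t n = b" using P by (auto simp: tagged_partition_def)
  have step: "t k < t (Suc k) \<and> \<xi> (Suc k) \<in> {t k..t (Suc k)}" if "k < n" for k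
    using P that unfolding tagged_partition_def by force
  have S: "t i \<in> {a..b}" if "i \<le> n" for i using mono[of 0 i] mono[of i n] ends that by auto
  define \<theta> where "\<theta> = \<beta> + \<gamma>"
  have sum: "riemann_stieltjes_sum f g n t \<xi> = (\<Sum>k<n. f (\<xi> (Suc k)) * (g (t (Suc k)) - g (t k)))"
    unfolding riemann_stieltjes_sum_def
    by (rule sum.reindex_bij_witness[of _ Suc "\<lambda>k. k - 1"]) auto
  have "\<bar>(\<Sum>k<n. f (\<xi> (Suc k)) * (g (t (Suc k)) - g (t k))) - (\<Sum>k<n. f (t k) * (g (t (Suc k)) - g (t k)))\<bar>
     = \<bar>\<Sum>k<n. (f (\<xi> (Suc k)) - f (t k)) * (g (t (Suc k)) - g (t k))\<bar>"
    by (simp add: left_diff_distrib sum_subtractf)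
  also have "\<dots> \<le> (\<Sum>k<n. K * L * (b - a) powr (\<theta> - 1) * (t (Suc k) - t k))"
  proof (rule order_trans[OF sum_abs], rule sum_mono)
    fix k assume "k \<in> {..<n}"
    then have k: "k < n" by simp
    define D where "D = t (Suc k) - t k"
    have D: "0 < D" "D \<le> b - a" using step[OF k] S[of k] S[of "Suc k"] k by (auto simp: D_def)
    have "\<bar>f (\<xi> (Suc k)) - f (t k)\<bar> \<le> K * D powr \<beta>"
      by (rule order_trans[OF f mult_left_mono[OF powr_mono2]])
        (use step[OF k] S[of k] S[of "Suc k"] k pos in \<open>auto simp: D_def\<close>)
    moreover have "\<bar>g (t (Suc k)) - g (t k)\<bar> \<le> L * D powr \<gamma>"
      using g[of "t (Suc k)" "t k"] S[of k] S[of "Suc k"] k D by (auto simp: D_def)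
    ultimately have "\<bar>f (\<xi> (Suc k)) - f (t k)\<bar> * \<bar>g (t (Suc k)) - g (t k)\<bar> \<le> (K * D powr \<beta>) * (L * D powr \<gamma>)"
      using pos by (intro mult_mono) auto
    also have "\<dots> = K * L * (D powr (\<theta> - 1) * D)"
      using D by (simp add: \<theta>_def powr_add powr_diff)
    also have "\<dots> \<le> K * L * ((b - a) powr (\<theta> - 1) * D)"
      using D pos \<theta> by (intro mult_left_mono mult_right_mono powr_mono2) (auto simp: \<theta>_def)
    finally show "\<bar>(f (\<xi> (Suc k)) - f (t k)) * (g (t (Suc k)) - g (t k))\<bar> \<le> K * L * (b - a) powr (\<theta> - 1) * (t (Suc k) - t k)"
      by (simp add: abs_mult D_def mult_ac)
  qed
  also have "\<dots> = K * L * (b - a) powr (\<theta> - 1) * (b - a)"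
    using sum_lessThan_telescope[of t n] ends by (simp add: sum_distrib_left[symmetric])
  also have "\<dots> = K * L * (b - a) powr \<theta>"
    using S[of 0] ends by (cases "a = b") (auto simp: powr_diff)
  finally have 1: "\<bar>(\<Sum>k<n. f (\<xi> (Suc k)) * (g (t (Suc k)) - g (t k))) - (\<Sum>k<n. f (t k) * (g (t (Suc k)) - g (t k)))\<bar>
     \<le> K * L * (b - a) powr \<theta>" .
  have 2: "\<bar>(\<Sum>k<n. f (t k) * (g (t (Suc k)) - g (t k))) - f a * (g b - g a)\<bar>
    \<le> 2 / (1 - 2 powr (1 - \<theta>)) * K * L * (b - a) powr \<theta>"
    using young_loeve_bound[of "{a..b}" f K \<beta> g L \<gamma> n t 0 n, OF f g pos \<theta> mono S] ends
    by (auto simp: \<theta>_def atLeast0LessThan)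
  have 3: "\<bar>f a * (g b - g a)\<bar> = \<bar>f a\<bar> * \<bar>g b - g a\<bar>" by (rule abs_mult)
  show ?thesis unfolding sum \<theta>_def[symmetric] using 1 2 3
    by (simp add: distrib_right)
qed

section \<open>Uniform partitions and approximation of the integrand\<close>

definition uniform_node :: "real \<Rightarrow> real \<Rightarrow> nat \<Rightarrow> nat \<Rightarrow> real" where
  "uniform_node a b n k = a + real k * ((b - a) / real n)"

lemma uniform_node_diff:
  assumes "k \<in> {1..Suc n}"
  shows "uniform_node a b (Suc n) k - uniform_node a b (Suc n) (k - 1) = (b - a) / real (Suc n)"
  using assms by (simp add: uniform_node_def of_nat_diff left_diff_distrib diff_divide_distrib del: of_nat_Suc)

lemma tagged_partition_uniform:
  assumes "a < b"
  shows "tagged_partition a b (Suc n) (uniform_node a b (Suc n)) (uniform_node a b (Suc n))"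
proof -
  have "0 < (b - a) / real (Suc n)" using assms by simp
  then have *: "uniform_node a b (Suc n) (k - 1) < uniform_node a b (Suc n) k"
    if "k \<in> {1..Suc n}" for k
    using uniform_node_diff[OF that, of a b] by linarith
  have "uniform_node a b (Suc n) 0 = a" "uniform_node a b (Suc n) (Suc n) = b"
    by (simp_all add: uniform_node_def del: of_nat_Suc)
  then show ?thesis unfolding tagged_partition_def using * by (auto simp: less_imp_le)
qed

definition uniform_rs_sum :: "(real \<Rightarrow> real) \<Rightarrow> (real \<Rightarrow> real) \<Rightarrow> real \<Rightarrow> real \<Rightarrow> nat \<Rightarrow> real" where
  "uniform_rs_sum f g a b n =
     riemann_stieltjes_sum f g (Suc n) (uniform_node a b (Suc n)) (uniform_node a b (Suc n))"

lemma rs_integral_imp_uniform_limit: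
  assumes "a < b" "has_rs_integral f g a b I"
  shows "uniform_rs_sum f g a b \<longlonglongrightarrow> I"
proof (rule LIMSEQ_I)
  fix e :: real assume "e > 0"
  then obtain d where d: "d > 0" "\<And>n t \<xi>. tagged_partition a b n t \<xi> \<Longrightarrow>
      \<forall>k\<in>{1..n}. t k - t (k - 1) < d \<Longrightarrow> \<bar>riemann_stieltjes_sum f g n t \<xi> - I\<bar> < e"
    using assms(2) unfolding has_rs_integral_def by meson
  obtain N :: nat where N: "(b - a) / d < real N" using reals_Archimedean2 by blast
  show "\<exists>N. \<forall>n\<ge>N. norm (uniform_rs_sum f g a b n - I) < e"
  proof (intro exI[of _ N] allI impI)
    fix n assume n: "n \<ge> N"
    have "(b - a) / d < real (Suc n)" using N n by linarith
    then have "(b - a) / real (Suc n) < d"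
      using assms(1) d(1) by (auto simp: field_simps simp del: of_nat_Suc)
    then show "norm (uniform_rs_sum f g a b n - I) < e"
      unfolding uniform_rs_sum_def real_norm_def
      by (intro d(2) tagged_partition_uniform assms(1) ballI) (simp only: uniform_node_diff)
  qed
qed

text \<open>A uniform limit of integrable integrands is integrable, where closeness is measured by the
  Riemann-Stieltjes sums over all partitions.  The sums over uniform partitions form a Cauchy sequence
  and provide the value of the integral.\<close>

lemma rs_integrable_approx:
  fixes f g :: "real \<Rightarrow> real"
  assumes "a < b"
    and app: "\<And>\<epsilon>. \<epsilon> > 0 \<Longrightarrow> \<exists>h I. has_rs_integral h g a b I \<and>
       (\<forall>n t \<xi>. tagged_partition a b n t \<xi> \<longrightarrow>
          \<bar>riemann_stieltjes_sum f g n t \<xi> - riemann_stieltjes_sum h g n t \<xi>\<bar> < \<epsilon>)"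
  shows "\<exists>I. has_rs_integral f g a b I"
proof -
  define u where "u = uniform_rs_sum f g a b"
  have "Cauchy u"
  proof (rule CauchyI)
    fix e :: real assume e: "e > 0"
    then obtain h I where hI: "has_rs_integral h g a b I"
      and close: "\<And>n t \<xi>. tagged_partition a b n t \<xi> \<Longrightarrow>
          \<bar>riemann_stieltjes_sum f g n t \<xi> - riemann_stieltjes_sum h g n t \<xi>\<bar> < e / 4"
      using app[of "e / 4"] by auto
    obtain N where N: "\<And>n. n \<ge> N \<Longrightarrow> \<bar>uniform_rs_sum h g a b n - I\<bar> < e / 4"
      using LIMSEQ_D[OF rs_integral_imp_uniform_limit[OF assms(1) hI], of "e / 4"] e by auto
    have "\<bar>u n - I\<bar> < e / 2" if "n \<ge> N" for n
      using N[OF that] close[OF tagged_partition_uniform[OF assms(1), of n]]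
      unfolding u_def uniform_rs_sum_def by linarith
    then show "\<exists>N. \<forall>m\<ge>N. \<forall>n\<ge>N. norm (u m - u n) < e"
      by (intro exI[of _ N] allI impI) (smt (verit, best) real_norm_def field_sum_of_halves)
  qed
  then obtain L where L: "u \<longlonglongrightarrow> L" by (metis Cauchy_convergent_iff convergent_def)
  have "has_rs_integral f g a b L"
    unfolding has_rs_integral_def
  proof (intro allI impI)
    fix e :: real assume e: "e > 0"
    then obtain h I where hI: "has_rs_integral h g a b I"
      and close: "\<And>n t \<xi>. tagged_partition a b n t \<xi> \<Longrightarrow>
          \<bar>riemann_stieltjes_sum f g n t \<xi> - riemann_stieltjes_sum h g n t \<xi>\<bar> < e / 4"
      using app[of "e / 4"] by auto
    have "\<bar>L - I\<bar> \<le> e / 4"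
    proof (rule LIMSEQ_le_const2)
      show "(\<lambda>n. \<bar>u n - uniform_rs_sum h g a b n\<bar>) \<longlonglongrightarrow> \<bar>L - I\<bar>"
        by (intro tendsto_intros L rs_integral_imp_uniform_limit assms(1) hI)
      show "\<exists>N. \<forall>n\<ge>N. \<bar>u n - uniform_rs_sum h g a b n\<bar> \<le> e / 4"
        unfolding u_def uniform_rs_sum_def
        using close[OF tagged_partition_uniform[OF assms(1)]] by (auto intro: less_imp_le)
    qed
    obtain \<delta> where \<delta>: "\<delta> > 0" "\<And>n t \<xi>. tagged_partition a b n t \<xi> \<and> (\<forall>k\<in>{1..n}. t k - t (k - 1) < \<delta>) \<Longrightarrow>
        \<bar>riemann_stieltjes_sum h g n t \<xi> - I\<bar> < e / 4"
      using hI[unfolded has_rs_integral_def, rule_format, of "e / 4"] e by auto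
    show "\<exists>\<delta>>0. \<forall>n t \<xi>. tagged_partition a b n t \<xi> \<and> (\<forall>k\<in>{1..n}. t k - t (k - 1) < \<delta>) \<longrightarrow>
        \<bar>riemann_stieltjes_sum f g n t \<xi> - L\<bar> < e"
    proof (intro exI[of _ \<delta>] conjI allI impI \<delta>(1))
      fix n t \<xi> assume A: "tagged_partition a b n t \<xi> \<and> (\<forall>k\<in>{1..n}. t k - t (k - 1) < \<delta>)"
      show "\<bar>riemann_stieltjes_sum f g n t \<xi> - L\<bar> < e"
        using \<delta>(2)[OF A] close[of n t \<xi>] A \<open>\<bar>L - I\<bar> \<le> e / 4\<close> e by linarith
    qed
  qed
  then show ?thesis by blast
qed

section \<open>The Young integral of Hoelder functions\<close>

text \<open>The approximation is the moving average of \<open>f\<close> over windows of length \<open>h\<close>, written as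
  \<open>(F (x + h) - F x) / h\<close> with an antiderivative \<open>F\<close>.  By the mean value theorem it is \<open>h powr \<beta>\<close>-close
  to \<open>f\<close> and inherits its Hoelder constant.  Interpolating between these two facts gives convergence as
  \<open>h \<rightarrow> 0\<close> in every Hoelder norm of smaller order \<open>\<beta>'\<close>.\<close>

lemma holder_average_approximation:
  fixes f :: "real \<Rightarrow> real"
  assumes "a \<le> b" "0 < h" "0 \<le> K" "0 < \<beta>" "0 < \<beta>'" "\<beta>' < \<beta>"
    and f: "\<And>x y. x \<in> {a..b} \<Longrightarrow> y \<in> {a..b} \<Longrightarrow> \<bar>f x - f y\<bar> \<le> K * \<bar>x - y\<bar> powr \<beta>"
  obtains \<phi> \<phi>' where "C1_on_with_deriv a b \<phi> \<phi>'"
    "\<And>x. x \<in> {a..b} \<Longrightarrow> \<bar>f x - \<phi> x\<bar> \<le> K * h powr \<beta>"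
    "\<And>x y. x \<in> {a..b} \<Longrightarrow> y \<in> {a..b} \<Longrightarrow>
       \<bar>(f x - \<phi> x) - (f y - \<phi> y)\<bar> \<le> 2 * K * h powr (\<beta> - \<beta>') * \<bar>x - y\<bar> powr \<beta>'"
proof -
  \<comment> \<open>constant continuation beyond the interval, so that averages near \<open>b\<close> make sense\<close>
  define p where "p x = f (max a (min b x))" for x
  have pf: "p x = f x" if "x \<in> {a..b}" for x using that by (simp add: p_def)
  have p: "\<bar>p x - p y\<bar> \<le> K * \<bar>x - y\<bar> powr \<beta>" for x y
  proof -
    have "\<bar>p x - p y\<bar> \<le> K * \<bar>max a (min b x) - max a (min b y)\<bar> powr \<beta>"
      unfolding p_def using assms(1) by (intro f) auto
    also have "\<dots> \<le> K * \<bar>x - y\<bar> powr \<beta>"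
      using assms by (intro mult_left_mono powr_mono2) auto
    finally show ?thesis .
  qed
  have cont: "isCont p x" for x
    unfolding isCont_def
  proof (rule metric_tendsto_imp_tendsto)
    show "((\<lambda>y. K * \<bar>y - x\<bar> powr \<beta>) \<longlongrightarrow> 0) (at x)"
    proof -
      have "((\<lambda>y. K * \<bar>y - x\<bar> powr \<beta>) \<longlongrightarrow> K * \<bar>x - x\<bar> powr \<beta>) (at x)"
        using assms by (intro tendsto_intros) auto
      then show ?thesis by simp
    qed
    show "eventually (\<lambda>y. dist (p y) (p x) \<le> dist (K * \<bar>y - x\<bar> powr \<beta>) 0) (at x)"
      using p assms by (auto simp: dist_real_def)
  qed
  have "\<exists>F. \<forall>x. -\<infinity> < ereal x \<longrightarrow> ereal x < \<infinity> \<longrightarrow> (F has_vector_derivative p x) (at x)"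
    using cont by (intro einterval_antiderivative) auto
  then obtain F where F: "(F has_real_derivative p x) (at x)" for x
    by (auto simp: has_real_derivative_iff_has_vector_derivative)
  define \<phi> where "\<phi> = (\<lambda>x. (F (x + h) - F x) / h)"
  define \<phi>' where "\<phi>' = (\<lambda>x. (p (x + h) - p x) / h)"
  have d: "((\<lambda>u. F (x + u)) has_real_derivative p (x + u)) (at u)" for x u
    by (rule DERIV_chain'[where f="\<lambda>u. x + u" and D=1 and g=F and E="p (x+u)", simplified])
      (auto intro!: derivative_eq_intros F)
  have d': "((\<lambda>u. F (u + x)) has_real_derivative p (u + x)) (at u)" for x u
    using d[of x u] by (simp add: add.commute)
  have "(\<phi> has_real_derivative \<phi>' x) (at x)" for x
    unfolding \<phi>_def \<phi>'_def using assms by (intro DERIV_cdivide DERIV_diff d' F)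
  moreover have "continuous_on {a..b} \<phi>'"
    unfolding \<phi>'_def
    by (intro continuous_at_imp_continuous_on ballI continuous_intros isCont_o2[OF _ cont] cont) (use assms in auto)
  ultimately have C1: "C1_on_with_deriv a b \<phi> \<phi>'"
    unfolding C1_on_with_deriv_def by (auto intro: has_field_derivative_at_within)
  have close: "\<bar>p x - \<phi> x\<bar> \<le> K * h powr \<beta>" for x
  proof -
    obtain z where z: "0 < z" "z < h" "F (x + h) - F (x + 0) = (h - 0) * p (x + z)"
      using MVT2[of 0 h "\<lambda>u. F (x + u)" "\<lambda>u. p (x + u)"] assms d by auto
    then have "\<phi> x = p (x + z)" using assms by (simp add: \<phi>_def)
    then have "\<bar>p x - \<phi> x\<bar> \<le> K * z powr \<beta>" using p[of x "x+z"] z by simp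
    also have "\<dots> \<le> K * h powr \<beta>" using assms z by (intro mult_left_mono powr_mono2) auto
    finally show ?thesis .
  qed
  have hold: "\<bar>\<phi> x - \<phi> y\<bar> \<le> K * \<bar>x - y\<bar> powr \<beta>" for x y
  proof -
    obtain z where "0 < z" "z < h"
      "(F (x + h) - F (y + h)) - (F (x + 0) - F (y + 0)) = (h - 0) * (p (x + z) - p (y + z))"
      using MVT2[of 0 h "\<lambda>u. F (x + u) - F (y + u)" "\<lambda>u. p (x + u) - p (y + u)", OF \<open>0 < h\<close> DERIV_diff[OF d d]]
      by blast
    then have "\<phi> x - \<phi> y = h * (p (x + z) - p (y + z)) / h"
      unfolding \<phi>_def diff_divide_distrib[symmetric] by (simp add: algebra_simps)
    then have "\<phi> x - \<phi> y = p (x + z) - p (y + z)" using assms by simp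
    then show ?thesis using p[of "x+z" "y+z"] by simp
  qed
  show ?thesis
  proof (rule that[OF C1])
    show "\<bar>f x - \<phi> x\<bar> \<le> K * h powr \<beta>" if "x \<in> {a..b}" for x using close[of x] pf[OF that] by simp
  next
    fix x y assume xy: "x \<in> {a..b}" "y \<in> {a..b}"
    let ?\<Delta> = "\<bar>(f x - \<phi> x) - (f y - \<phi> y)\<bar>"
    show "?\<Delta> \<le> 2 * K * h powr (\<beta> - \<beta>') * \<bar>x - y\<bar> powr \<beta>'"
    proof (cases "\<bar>x - y\<bar> \<le> h")
      case True
      have "?\<Delta> \<le> 2 * K * \<bar>x - y\<bar> powr \<beta>" using hold[of x y] f[OF xy] by linarith
      also have "\<bar>x - y\<bar> powr \<beta> = \<bar>x - y\<bar> powr (\<beta> - \<beta>') * \<bar>x - y\<bar> powr \<beta>'"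
        by (simp flip: powr_add)
      also have "2 * K * \<dots> \<le> 2 * K * (h powr (\<beta> - \<beta>') * \<bar>x - y\<bar> powr \<beta>')"
        using True assms by (intro mult_left_mono mult_right_mono powr_mono2) auto
      finally show ?thesis by (simp add: mult_ac)
    next
      case False
      have "?\<Delta> \<le> 2 * K * h powr \<beta>" using close[of x] close[of y] pf xy by simp
      also have "h powr \<beta> = h powr (\<beta> - \<beta>') * h powr \<beta>'"
        by (simp flip: powr_add)
      also have "2 * K * \<dots> \<le> 2 * K * (h powr (\<beta> - \<beta>') * \<bar>x - y\<bar> powr \<beta>')"
        using False assms by (intro mult_left_mono mult_right_mono powr_mono2) auto
      finally show ?thesis by (simp add: mult_ac)
    qed
  qed
qed

lemma holder_continuous_onE:
  fixes f :: "real \<Rightarrow> real"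
  assumes "holder_continuous_on S \<beta> f"
  obtains K where "K \<ge> 0" "\<And>x y. x \<in> S \<Longrightarrow> y \<in> S \<Longrightarrow> \<bar>f x - f y\<bar> \<le> K * \<bar>x - y\<bar> powr \<beta>"
proof -
  obtain K where K: "\<And>x y. x \<in> S \<Longrightarrow> y \<in> S \<Longrightarrow> \<bar>f x - f y\<bar> \<le> K * \<bar>x - y\<bar> powr \<beta>"
    using assms unfolding holder_continuous_on_def by blast
  have "K * c powr \<beta> \<le> \<bar>K\<bar> * c powr \<beta>" for c by (intro mult_right_mono) auto
  then show ?thesis using order_trans[OF K] by (intro that[of "\<bar>K\<bar>"]) auto
qed

text \<open>Averages of \<open>f\<close> are continuously differentiable, so their integrals against the continuous \<open>g\<close>
  exist by parts.  They approximate \<open>f\<close> in a Hoelder norm of an order \<open>\<beta>' < \<beta>\<close> with \<open>\<beta>' + \<gamma> > 1\<close>, for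
  which Young's inequality turns closeness of integrands into closeness of the sums.\<close>

lemma young_rs_integrable:
  fixes f g :: "real \<Rightarrow> real"
  assumes "a < b" "0 < \<beta>" "0 < \<gamma>" "\<beta> + \<gamma> > 1"
    and "holder_continuous_on {a..b} \<beta> f" "holder_continuous_on {a..b} \<gamma> g"
  shows "\<exists>I. has_rs_integral f g a b I"
proof -
  obtain K where K: "K \<ge> 0" and f: "\<And>x y. x \<in> {a..b} \<Longrightarrow> y \<in> {a..b} \<Longrightarrow> \<bar>f x - f y\<bar> \<le> K * \<bar>x - y\<bar> powr \<beta>"
    using holder_continuous_onE[OF assms(5)] by blast
  obtain L where L: "L \<ge> 0" and g: "\<And>x y. x \<in> {a..b} \<Longrightarrow> y \<in> {a..b} \<Longrightarrow> \<bar>g x - g y\<bar> \<le> L * \<bar>x - y\<bar> powr \<gamma>"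
    using holder_continuous_onE[OF assms(6)] by blast
  have cg: "continuous_on {a..b} g"
    unfolding continuous_on_def
  proof (intro ballI)
    fix x assume x: "x \<in> {a..b}"
    show "(g \<longlongrightarrow> g x) (at x within {a..b})"
    proof (rule metric_tendsto_imp_tendsto)
    have "((\<lambda>y. L * \<bar>y - x\<bar> powr \<gamma>) \<longlongrightarrow> L * \<bar>x - x\<bar> powr \<gamma>) (at x within {a..b})"
      using assms by (intro tendsto_intros) auto
    then show "((\<lambda>y. L * \<bar>y - x\<bar> powr \<gamma>) \<longlongrightarrow> 0) (at x within {a..b})" by simp
    show "eventually (\<lambda>y. dist (g y) (g x) \<le> dist (L * \<bar>y - x\<bar> powr \<gamma>) 0) (at x within {a..b})"
      unfolding eventually_at_filter dist_real_def
      by (intro always_eventually allI impI order_trans[OF g[OF _ x]]) auto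
    qed
  qed
  define \<beta>' where "\<beta>' = (\<beta> + max 0 (1 - \<gamma>)) / 2"
  have \<beta>': "0 < \<beta>'" "\<beta>' < \<beta>" "\<beta>' + \<gamma> > 1" using assms by (auto simp: \<beta>'_def max_def field_simps)
  define C where "C = (2 / (1 - 2 powr (1 - (\<beta>' + \<gamma>))) + 1)"
  \<comment> \<open>Young's bound for the difference of \<open>f\<close> and its average over windows of length \<open>h\<close>\<close>
  define E where "E h = K * h powr \<beta> * \<bar>g b - g a\<bar> + C * (2 * K * h powr (\<beta> - \<beta>')) * L * (b - a) powr (\<beta>' + \<gamma>)" for h
  have "2 powr (1 - (\<beta>' + \<gamma>)) < 1" using \<beta>' by (simp add: powr_less_one)
  then have C: "C \<ge> 0" by (simp add: C_def)
  have E0: "(E \<longlongrightarrow> 0) (at_right 0)"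
  proof -
    have "((\<lambda>h. h powr c) \<longlongrightarrow> 0) (at_right (0::real))" if "c > 0" for c
    proof -
      have "eventually (\<lambda>h. 0 \<le> h) (at_right (0::real))"
        using eventually_at_right_less[of "0::real"] by eventually_elim simp
      then have "((\<lambda>h. h powr c) \<longlongrightarrow> 0 powr c) (at_right (0::real))"
        using that by (intro tendsto_powr' tendsto_ident_at tendsto_const) auto
      then show ?thesis by simp
    qed
    from this[of \<beta>] this[of "\<beta> - \<beta>'"]
    have "(E \<longlongrightarrow> K * 0 * \<bar>g b - g a\<bar> + C * (2 * K * 0) * L * (b - a) powr (\<beta>' + \<gamma>)) (at_right 0)"
      unfolding E_def using assms \<beta>' by (intro tendsto_add tendsto_mult tendsto_const) auto
    then show ?thesis by simp
  qed
  show ?thesis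
  proof (rule rs_integrable_approx[OF \<open>a < b\<close>])
    fix e :: real assume e: "e > 0"
    have "eventually (\<lambda>h. E h < e \<and> h > 0) (at_right 0)"
      using order_tendstoD(2)[OF E0 e] by (auto intro: eventually_conj eventually_at_right_less)
    then obtain h where h: "E h < e" "h > 0"
      using eventually_happens'[of "at_right (0::real)"] trivial_limit_at_right_real by blast
    obtain \<phi> \<phi>' where C1: "C1_on_with_deriv a b \<phi> \<phi>'"
      and c: "\<And>x. x \<in> {a..b} \<Longrightarrow> \<bar>f x - \<phi> x\<bar> \<le> K * h powr \<beta>"
      and hd: "\<And>x y. x \<in> {a..b} \<Longrightarrow> y \<in> {a..b} \<Longrightarrow>
         \<bar>(f x - \<phi> x) - (f y - \<phi> y)\<bar> \<le> 2 * K * h powr (\<beta> - \<beta>') * \<bar>x - y\<bar> powr \<beta>'"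
      using holder_average_approximation[of a b h K \<beta> \<beta>' f] assms h K \<beta>' f by (metis less_imp_le)
    show "\<exists>h I. has_rs_integral h g a b I \<and>
       (\<forall>n t \<xi>. tagged_partition a b n t \<xi> \<longrightarrow>
          \<bar>riemann_stieltjes_sum f g n t \<xi> - riemann_stieltjes_sum h g n t \<xi>\<bar> < e)"
    proof (intro exI conjI allI impI)
      show "has_rs_integral \<phi> g a b (\<phi> b * g b - \<phi> a * g a - integral {a..b} (\<lambda>s. g s * \<phi>' s))"
        by (rule rs_integral_by_parts[OF \<open>a < b\<close> C1 cg])
      fix n t \<xi> assume P: "tagged_partition a b n t \<xi>"
      have "riemann_stieltjes_sum f g n t \<xi> - riemann_stieltjes_sum \<phi> g n t \<xi>
         = riemann_stieltjes_sum (\<lambda>x. f x - \<phi> x) g n t \<xi>"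
        by (simp add: riemann_stieltjes_sum_def left_diff_distrib sum_subtractf)
      also have "\<bar>\<dots>\<bar> \<le> \<bar>f a - \<phi> a\<bar> * \<bar>g b - g a\<bar> + C * (2 * K * h powr (\<beta> - \<beta>')) * L * (b - a) powr (\<beta>' + \<gamma>)"
        unfolding C_def
        by (rule rs_sum_holder_bound[where f="\<lambda>x. f x - \<phi> x", OF hd g _ L \<beta>'(1) assms(3) \<beta>'(3) P]) (use K in auto)
      also have "\<dots> \<le> E h"
        unfolding E_def using c[of a] \<open>a < b\<close> by (intro add_right_mono mult_right_mono) auto
      finally show "\<bar>riemann_stieltjes_sum f g n t \<xi> - riemann_stieltjes_sum \<phi> g n t \<xi>\<bar> < e"
        using h by simp
    qed
  qed
qed

section \<open>Hoelder continuity from dyadic increments\<close>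

text \<open>Chaining: the dyadic points \<open>d n x\<close> of level \<open>n\<close> just below \<open>x\<close> increase to \<open>x\<close>, and consecutive
  ones are equal or neighbours, so \<open>g x - g (d n x)\<close> is bounded by a geometric series.  Two points at
  distance comparable to \<open>T / 2 ^ n\<close> have equal or neighbouring level-\<open>n\<close> points.\<close>

lemma holder_from_dyadic_increments:
  fixes g :: "real \<Rightarrow> real"
  assumes "T > 0" and cont: "continuous_on {0..T} g" and "\<gamma> > 0" "A \<ge> 0"
    and inc: "\<And>n k. k < 2 ^ n \<Longrightarrow>
      \<bar>g (real (Suc k) * T / 2 ^ n) - g (real k * T / 2 ^ n)\<bar> \<le> A * 2 powr (- \<gamma> * real n)"
  shows "holder_continuous_on {0..T} \<gamma> g"
proof -
  define idx where "idx n x = nat \<lfloor>x * 2 ^ n / T\<rfloor>" for n :: nat and x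
  define d where "d n x = real (idx n x) * T / 2 ^ n" for n :: nat and x
  define q where "q = 2 powr (-\<gamma>)"
  have q: "0 < q" "q < 1" using assms by (auto simp: q_def powr_less_one)
  have qn: "2 powr (- \<gamma> * real n) = q ^ n" for n
    by (simp add: q_def powr_power mult_ac)
  have idx: "real (idx n x) \<le> x * 2 ^ n / T" "x * 2 ^ n / T < real (idx n x) + 1" if "x \<ge> 0" for n x
    using that assms unfolding idx_def by (auto simp: of_nat_nat)
  have d: "d n x \<le> x" "x - d n x < T / 2 ^ n" if "x \<ge> 0" for n x
  proof -
    show "d n x \<le> x" using idx(1)[OF that, of n] assms by (simp add: d_def field_simps)
    have "x < (real (idx n x) + 1) * T / 2 ^ n"
      using idx(2)[OF that, of n] assms by (simp add: field_simps)
    then show "x - d n x < T / 2 ^ n" by (simp add: d_def ring_distribs add_divide_distrib)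
  qed
  have d0: "d n x \<ge> 0" for n x using assms by (simp add: d_def)
  have lim: "(\<lambda>n. d n x) \<longlonglongrightarrow> x" if "x \<ge> 0" for x
  proof (rule tendsto_sandwich)
    show "\<forall>\<^sub>F n in sequentially. x - T * (1/2) ^ n \<le> d n x"
      using d(2)[OF that] by (intro always_eventually allI) (auto simp: power_divide less_imp_le algebra_simps)
    show "\<forall>\<^sub>F n in sequentially. d n x \<le> x" using d(1)[OF that] by simp
    have "(\<lambda>n. x - T * (1/2) ^ n) \<longlonglongrightarrow> x - T * 0" by (intro tendsto_intros LIMSEQ_power_zero) auto
    then show "(\<lambda>n. x - T * (1/2) ^ n) \<longlonglongrightarrow> x" by simp
  qed auto
  have step: "\<bar>g (d (Suc n) x) - g (d n x)\<bar> \<le> A * q ^ Suc n" if x: "x \<in> {0..T}" for n x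
  proof -
    have "real (2 * idx n x) \<le> x * 2 ^ Suc n / T" "x * 2 ^ Suc n / T < real (2 * idx n x) + 2"
      using idx[of x n] x \<open>T > 0\<close> by (auto simp: field_simps)
    with idx[of x "Suc n"] x have "real (2 * idx n x) < real (idx (Suc n) x) + 1" "real (idx (Suc n) x) < real (2 * idx n x) + 2"
      by auto
    then consider "idx (Suc n) x = 2 * idx n x" | "idx (Suc n) x = Suc (2 * idx n x)" by linarith
    then show ?thesis
    proof cases
      case 1 then have "d (Suc n) x = d n x" by (simp add: d_def)
      then show ?thesis using q assms by simp
    next
      case 2
      have "real (idx (Suc n) x) \<le> x * 2 ^ Suc n / T" using idx[of x "Suc n"] x by auto
      also have "\<dots> \<le> 2 ^ Suc n" using x assms by (simp add: field_simps)
      finally have "idx (Suc n) x \<le> 2 ^ Suc n" by (metis of_nat_le_iff of_nat_numeral of_nat_power)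
      then have "2 * idx n x < 2 ^ Suc n" using 2 by linarith
      from inc[OF this] 2 show ?thesis unfolding qn by (simp add: d_def)
    qed
  qed
  define c where "c = q / (1 - q)"
  have c: "c \<ge> 0" "c * q + q = c" using q by (auto simp: c_def field_simps)
  have chain: "\<bar>g (d (n + m) x) - g (d n x)\<bar> \<le> A * c * q ^ n" if x: "x \<in> {0..T}" for n m x
  proof (induction m arbitrary: n)
    case 0 then show ?case using assms c q by simp
  next
    case (Suc m)
    have "\<bar>g (d (n + Suc m) x) - g (d n x)\<bar> \<le> A * c * q ^ Suc n + A * q ^ Suc n"
      using Suc[of "Suc n"] step[OF x, of n] by simp
    also have "\<dots> = A * (c * q + q) * q ^ n" by (simp add: algebra_simps)
    finally show ?case unfolding c(2) .
  qed
  have near: "\<bar>g x - g (d n x)\<bar> \<le> A * c * q ^ n" if x: "x \<in> {0..T}" for n x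
  proof (rule LIMSEQ_le_const2)
    have "(\<lambda>m. d (m + n) x) \<longlonglongrightarrow> x" using lim[of x] x by (intro LIMSEQ_ignore_initial_segment) auto
    moreover have "d (m + n) x \<in> {0..T}" for m using d(1)[of x] d0 x by (meson atLeastAtMost_iff order_trans)
    ultimately have "(\<lambda>m. g (d (m + n) x)) \<longlonglongrightarrow> g x"
      using cont x by (intro continuous_on_tendsto_compose[OF cont]) auto
    then show "(\<lambda>m. \<bar>g (d (n + m) x) - g (d n x)\<bar>) \<longlonglongrightarrow> \<bar>g x - g (d n x)\<bar>"
      by (intro tendsto_intros) (simp add: add.commute)
  qed (use chain[OF x] in auto)
  define B where "B = A * (2 * c + 1) * (2 / T) powr \<gamma>"
  have main: "\<bar>g x - g y\<bar> \<le> B * \<bar>x - y\<bar> powr \<gamma>"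
    if x: "x \<in> {0..T}" and y: "y \<in> {0..T}" and xy: "x < y" for x y
  proof -
    have "(\<lambda>n. T * (1/2) ^ n) \<longlonglongrightarrow> T * 0" by (intro tendsto_intros LIMSEQ_power_zero) auto
    then have "(\<lambda>n. T * (1/2) ^ n) \<longlonglongrightarrow> 0" by simp
    from order_tendstoD(2)[OF this, of "y - x"] xy
    obtain N where N: "T * (1/2) ^ N < y - x" by (auto simp: eventually_sequentially)
    \<comment> \<open>the level \<open>n\<close> with \<open>T / 2 ^ (n + 1) < y - x \<le> T / 2 ^ n\<close>\<close>
    define m where "m = (LEAST m. T * (1/2) ^ m < y - x)"
    have m: "T * (1/2) ^ m < y - x" unfolding m_def by (rule LeastI, rule N)
    have "m \<noteq> 0" using m x y by (intro notI) auto
    then obtain n where n: "m = Suc n" by (cases m) auto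
    have "\<not> T * (1/2) ^ n < y - x" unfolding n
      using not_less_Least[of n "\<lambda>m. T * (1/2) ^ m < y - x"] n by (simp add: m_def)
    then have le: "y - x \<le> T / 2 ^ n" by (simp add: power_divide)
    then have "y * 2 ^ n / T \<le> x * 2 ^ n / T + 1" using assms by (simp add: field_simps)
    then have "real (idx n y) < real (idx n x) + 2" using idx[of x n] idx[of y n] x y by auto
    moreover have "idx n x \<le> idx n y"
      unfolding idx_def using xy assms by (intro nat_mono floor_mono) (auto simp: field_simps)
    ultimately consider "idx n y = idx n x" | "idx n y = Suc (idx n x)" by linarith
    then have "\<bar>g (d n y) - g (d n x)\<bar> \<le> A * q ^ n"
    proof cases
      case 1 then show ?thesis using assms q by (simp add: d_def)
    next
      case 2
      have "real (idx n y) \<le> y * 2 ^ n / T" using idx[of y n] y by auto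
      also have "\<dots> \<le> 2 ^ n" using y assms by (simp add: field_simps)
      finally have "idx n y \<le> 2 ^ n" by (metis of_nat_le_iff of_nat_numeral of_nat_power)
      with 2 inc[of "idx n x" n] show ?thesis unfolding qn by (simp add: d_def)
    qed
    then have "\<bar>g x - g y\<bar> \<le> A * (2 * c + 1) * q ^ n"
      using near[OF x, of n] near[OF y, of n] by (simp add: algebra_simps)
    moreover have "q ^ n \<le> (2 / T) powr \<gamma> * (y - x) powr \<gamma>"
    proof -
      have "(1/2) ^ n \<le> 2 / T * (y - x)" using m n assms by (simp add: field_simps)
      then have "((1/2) ^ n) powr \<gamma> \<le> (2 / T * (y - x)) powr \<gamma>"
        using assms by (intro powr_mono2) auto
      also have "\<dots> = (2 / T) powr \<gamma> * (y - x) powr \<gamma>" by (rule powr_mult)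
      finally show ?thesis
        by (simp add: qn[symmetric] powr_realpow[symmetric] powr_powr powr_divide powr_minus_divide mult_ac)
    qed
    moreover have "0 \<le> A * (2 * c + 1)" using assms c by simp
    ultimately have "\<bar>g x - g y\<bar> \<le> A * (2 * c + 1) * ((2 / T) powr \<gamma> * (y - x) powr \<gamma>)"
      by (meson mult_left_mono order_trans)
    then show ?thesis using xy by (simp add: B_def mult_ac)
  qed
  show ?thesis unfolding holder_continuous_on_def
  proof (intro exI[of _ B] ballI)
    fix s t assume "s \<in> {0..T}" "t \<in> {0..T}"
    then show "\<bar>g s - g t\<bar> \<le> B * \<bar>s - t\<bar> powr \<gamma>"
      using main[of s t] main[of t s] by (cases s t rule: linorder_cases) (auto simp: abs_minus_commute)
  qed
qed

section \<open>Moments of Wiener integrals\<close>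

lemma step_nodes_mono:
  assumes "step_nodes n p" "i \<le> j" "j \<le> n"
  shows "p i \<le> p j"
  using assms(2,3)
proof (induction j rule: dec_induct)
  case (step m)
  then show ?case using assms(1) unfolding step_nodes_def by (smt (verit) Suc_le_eq less_imp_le)
qed simp

lemma step_nodes_nonneg: "step_nodes n p \<Longrightarrow> i \<le> n \<Longrightarrow> 0 \<le> p i"
  using step_nodes_mono[of n p 0 i] by (auto simp: step_nodes_def)

lemma step_wiener_integral_measurable:
  assumes "standard_brownian_motion M B" "step_nodes n p"
  shows "step_wiener_integral B n p c \<in> borel_measurable M"
proof -
  have "B (p k) \<in> borel_measurable M" if "k \<le> n" for k
    using assms(1) step_nodes_nonneg[OF assms(2) that] by (auto simp: standard_brownian_motion_def)
  then show ?thesis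
    unfolding step_wiener_integral_def[abs_def]
    by (intro borel_measurable_sum borel_measurable_times borel_measurable_diff borel_measurable_const) auto
qed

lemma step_fun_measurable [measurable]: "step_fun n p c \<in> borel_measurable borel"
  unfolding step_fun_def[abs_def] by measurable

lemma normal_even_moment:
  assumes "prob_space M" "\<sigma> > 0" "distributed M lborel X (normal_density 0 \<sigma>)"
  shows "(\<integral>\<^sup>+\<omega>. ennreal (X \<omega> ^ (2 * m)) \<partial>M) = ennreal (fact (2 * m) / (2 ^ m * fact m) * (\<sigma>\<^sup>2) ^ m)"
proof -
  have "(\<integral>\<^sup>+\<omega>. ennreal (X \<omega> ^ (2 * m)) \<partial>M) = (\<integral>\<^sup>+x. ennreal (normal_density 0 \<sigma> x) * ennreal (x ^ (2 * m)) \<partial>lborel)"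
    by (rule distributed_nn_integral[OF assms(3), symmetric]) measurable
  also have "\<dots> = (\<integral>\<^sup>+x. ennreal (normal_density 0 \<sigma> x * (x - 0) ^ (2 * m)) \<partial>lborel)"
    by (simp add: ennreal_mult' normal_density_nonneg)
  also have "\<dots> = ennreal (fact (2 * m) / ((2 / \<sigma>\<^sup>2) ^ m * fact m))"
    using normal_moment_even[OF assms(2), of 0 m]
    by (subst nn_integral_eq_integral) (auto simp: has_bochner_integral_iff)
  also have "fact (2 * m) / ((2 / \<sigma>\<^sup>2) ^ m * fact m) = fact (2 * m) / (2 ^ m * fact m) * (\<sigma>\<^sup>2) ^ m"
    using assms(2) by (simp add: power_divide field_simps)
  finally show ?thesis .
qed

text \<open>The summands are independent centred normal variables, so the sum is normal and its even moments
  are powers of its variance.  Summands with zero coefficient have no density and are dropped first.\<close>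

lemma step_wiener_integral_even_moment:
  assumes B: "standard_brownian_motion M B" and p: "step_nodes n p" and m: "m > 0"
  shows "(\<integral>\<^sup>+\<omega>. ennreal (step_wiener_integral B n p c \<omega> ^ (2 * m)) \<partial>M)
    = ennreal (fact (2 * m) / (2 ^ m * fact m) * (\<Sum>k<n. (c k)\<^sup>2 * (p (Suc k) - p k)) ^ m)"
proof -
  interpret prob_space M using B by (simp add: standard_brownian_motion_def)
  define J where "J = {k. k < n \<and> c k \<noteq> 0}"
  have J: "finite J" "J \<subseteq> {..<n}" by (auto simp: J_def)
  define Y where "Y = (\<lambda>k \<omega>. c k * (B (p (Suc k)) \<omega> - B (p k) \<omega>))"
  have eq: "step_wiener_integral B n p c \<omega> = (\<Sum>k\<in>J. Y k \<omega>)" for \<omega>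
    unfolding step_wiener_integral_def Y_def by (intro sum.mono_neutral_right J) (auto simp: J_def)
  have var: "(\<Sum>k<n. (c k)\<^sup>2 * (p (Suc k) - p k)) = (\<Sum>k\<in>J. (c k)\<^sup>2 * (p (Suc k) - p k))"
    by (intro sum.mono_neutral_right J) (auto simp: J_def)
  have pk: "0 \<le> p k \<and> p k < p (Suc k)" if "k \<in> J" for k
    using that J step_nodes_nonneg[OF p, of k] p by (auto simp: step_nodes_def)
  show ?thesis
  proof (cases "J = {}")
    case True then show ?thesis unfolding eq var using m by (simp add: zero_power)
  next
    case False
    define \<sigma> where "\<sigma> k = \<bar>c k\<bar> * sqrt (p (Suc k) - p k)" for k
    have \<sigma>: "\<sigma> k > 0" if "k \<in> J" for k using pk[OF that] that by (simp add: \<sigma>_def J_def)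
    have "indep_vars (\<lambda>_. borel) (\<lambda>k \<omega>. B (p (Suc k)) \<omega> - B (p k) \<omega>) {..<n}"
      using B p by (simp add: standard_brownian_motion_def step_nodes_def)
    then have "indep_vars (\<lambda>_. borel) (\<lambda>k \<omega>. B (p (Suc k)) \<omega> - B (p k) \<omega>) J"
      using J(2) by (rule indep_vars_subset)
    then have ind: "indep_vars (\<lambda>_. borel) Y J"
      unfolding Y_def by (rule indep_vars_compose2[where Y="\<lambda>k x. c k * x"]) measurable
    have dist: "distributed M lborel (Y k) (normal_density 0 (\<sigma> k))" if "k \<in> J" for k
    proof -
      have "distributed M lborel (\<lambda>\<omega>. B (p (Suc k)) \<omega> - B (p k) \<omega>) (normal_density 0 (sqrt (p (Suc k) - p k)))"
        using B pk[OF that] by (simp add: standard_brownian_motion_def)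
      from normal_density_affine[OF this, of "c k" 0] show ?thesis
        using pk[OF that] that by (simp add: Y_def \<sigma>_def J_def)
    qed
    have "distributed M lborel (\<lambda>\<omega>. \<Sum>k\<in>J. Y k \<omega>) (normal_density (\<Sum>k\<in>J. 0) (sqrt (\<Sum>k\<in>J. (\<sigma> k)\<^sup>2)))"
      by (intro sum_indep_normal J(1) False ind \<sigma> dist)
    then have D: "distributed M lborel (\<lambda>\<omega>. \<Sum>k\<in>J. Y k \<omega>) (normal_density 0 (sqrt (\<Sum>k\<in>J. (\<sigma> k)\<^sup>2)))"
      by simp
    have s: "(\<Sum>k\<in>J. (\<sigma> k)\<^sup>2) > 0" by (intro sum_pos J(1) False zero_less_power \<sigma>)
    have "(\<Sum>k\<in>J. (\<sigma> k)\<^sup>2) = (\<Sum>k\<in>J. (c k)\<^sup>2 * (p (Suc k) - p k))"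
      using pk by (intro sum.cong) (auto simp: \<sigma>_def power_mult_distrib less_imp_le)
    then show ?thesis
      unfolding eq var using normal_even_moment[OF prob_space_axioms _ D, of m] s by simp
  qed
qed

lemma step_fun_isometry:
  assumes p: "step_nodes n p"
  shows "(\<integral>\<^sup>+s. ennreal ((step_fun n p c s)\<^sup>2) \<partial>lborel) = ennreal (\<Sum>k<n. (c k)\<^sup>2 * (p (Suc k) - p k))"
proof -
  have pk: "p k < p (Suc k)" if "k < n" for k using that p by (simp add: step_nodes_def)
  have disj: "indicator {p k<..p (Suc k)} s * indicator {p l<..p (Suc l)} s = (0::real)"
    if "k < l" "l < n" for k l s
    using step_nodes_mono[OF p, of "Suc k" l] that by (auto simp: indicator_def)
  have sq: "(step_fun n p c s)\<^sup>2 = (\<Sum>k<n. (c k)\<^sup>2 * indicator {p k<..p (Suc k)} s)" for s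
  proof -
    have "(step_fun n p c s)\<^sup>2 = (\<Sum>k<n. \<Sum>l<n. (c k * c l) * (indicator {p k<..p (Suc k)} s * indicator {p l<..p (Suc l)} s))"
      unfolding step_fun_def power2_eq_square sum_product by (intro sum.cong refl) (simp only: mult_ac)
    also have "\<dots> = (\<Sum>k<n. \<Sum>l<n. if l = k then (c k)\<^sup>2 * indicator {p k<..p (Suc k)} s else 0)"
    proof (intro sum.cong refl)
      fix k l assume "k \<in> {..<n}" "l \<in> {..<n}"
      then show "(c k * c l) * (indicator {p k<..p (Suc k)} s * indicator {p l<..p (Suc l)} s)
        = (if l = k then (c k)\<^sup>2 * indicator {p k<..p (Suc k)} s else 0)"
        using disj[of k l s] disj[of l k s]
        by (cases k l rule: linorder_cases) (auto simp: power2_eq_square indicator_def)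
    qed
    finally show ?thesis by simp
  qed
  have "(\<integral>\<^sup>+s. ennreal ((step_fun n p c s)\<^sup>2) \<partial>lborel)
      = (\<integral>\<^sup>+s. (\<Sum>k<n. ennreal ((c k)\<^sup>2) * indicator {p k<..p (Suc k)} s) \<partial>lborel)"
    unfolding sq by (simp add: ennreal_mult' ennreal_indicator flip: sum_ennreal)
  also have "\<dots> = (\<Sum>k<n. ennreal ((c k)\<^sup>2) * emeasure lborel {p k<..p (Suc k)})"
    by (subst nn_integral_sum) (auto simp: nn_integral_cmult_indicator)
  also have "\<dots> = (\<Sum>k<n. ennreal ((c k)\<^sup>2 * (p (Suc k) - p k)))"
    using pk by (intro sum.cong refl) (auto simp: ennreal_mult' less_imp_le)
  also have "\<dots> = ennreal (\<Sum>k<n. (c k)\<^sup>2 * (p (Suc k) - p k))"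
    using pk by (intro sum_ennreal) (auto simp: less_imp_le)
  finally show ?thesis .
qed

lemma sum_increments_refine:
  fixes F :: "real \<Rightarrow> real"
  assumes "u i \<le> u (Suc i)" "u (Suc i) \<le> N"
  shows "F (q (u (Suc i))) - F (q (u i))
     = (\<Sum>k<N. if u i \<le> k \<and> k < u (Suc i) then F (q (Suc k)) - F (q k) else 0)"
proof -
  have "(\<Sum>k<N. if u i \<le> k \<and> k < u (Suc i) then F (q (Suc k)) - F (q k) else 0)
     = (\<Sum>k = u i..<u (Suc i). F (q (Suc k)) - F (q k))"
    using assms by (simp flip: sum.inter_filter) (intro sum.cong, auto)
  then show ?thesis using sum_Suc_diff'[OF assms(1), of "\<lambda>k. F (q k)"] by simp
qed

text \<open>The difference of two step functions is a step function on the union of the nodes.  Both the value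
  of a step function at a point and its Wiener integral have the form
  \<open>\<Sum> c k (F (p (k+1)) - F (p k))\<close>, with \<open>F\<close> the indicator of a half-line and a Brownian path
  respectively; the statement for arbitrary \<open>F\<close> covers both.\<close>

lemma common_refinement:
  assumes p: "step_nodes n p" and p': "step_nodes n' p'"
  obtains N q d where "step_nodes N q"
    "\<And>F :: real \<Rightarrow> real. (\<Sum>k<N. d k * (F (q (Suc k)) - F (q k)))
       = (\<Sum>k<n. c k * (F (p (Suc k)) - F (p k))) - (\<Sum>k<n'. c' k * (F (p' (Suc k)) - F (p' k)))"
proof -
  define P where "P = p ` {..n} \<union> p' ` {..n'}"
  have P: "finite P" "P \<noteq> {}" by (auto simp: P_def)
  define q where "q k = sorted_list_of_set P ! k" for k
  define N where "N = card P - 1"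
  have N: "Suc N = card P" using P by (simp add: N_def card_gt_0_iff)
  have q_mono: "q i < q j" if "i < j" "j \<le> N" for i j
    unfolding q_def using that N sorted_wrt_nth_less[OF strict_sorted_list_of_set[of P]] by simp
  have q_P: "q k \<in> P" if "k \<le> N" for k
    unfolding q_def using that N P nth_mem[of k "sorted_list_of_set P"] by simp
  have ex: "\<exists>k\<le>N. q k = x" if "x \<in> P" for x
  proof -
    have x: "x \<in> set (sorted_list_of_set P)" using that P by simp
    obtain k where "k < length (sorted_list_of_set P)" "sorted_list_of_set P ! k = x"
      using x unfolding in_set_conv_nth by blast
    then show ?thesis using N by (intro exI[of _ k]) (simp add: q_def)
  qed
  \<comment> \<open>positions of the nodes \<open>p i\<close> in the refined grid\<close>
  define u where "u i = (SOME k. k \<le> N \<and> q k = p i)" for i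
  define u' where "u' i = (SOME k. k \<le> N \<and> q k = p' i)" for i
  have u: "u i \<le> N" "q (u i) = p i" if "i \<le> n" for i
    using someI_ex[of "\<lambda>k. k \<le> N \<and> q k = p i"] ex[of "p i"] that by (auto simp: u_def P_def)
  have u': "u' i \<le> N" "q (u' i) = p' i" if "i \<le> n'" for i
    using someI_ex[of "\<lambda>k. k \<le> N \<and> q k = p' i"] ex[of "p' i"] that by (auto simp: u'_def P_def)
  have ui: "u i \<le> u (Suc i)" if "i < n" for i
  proof (rule ccontr)
    assume "\<not> u i \<le> u (Suc i)"
    then have "p (Suc i) < p i"
      using q_mono[of "u (Suc i)" "u i"] u[of i] u[of "Suc i"] that by simp
    then show False using p that unfolding step_nodes_def by fastforce
  qed
  have ui': "u' i \<le> u' (Suc i)" if "i < n'" for i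
  proof (rule ccontr)
    assume "\<not> u' i \<le> u' (Suc i)"
    then have "p' (Suc i) < p' i"
      using q_mono[of "u' (Suc i)" "u' i"] u'[of i] u'[of "Suc i"] that by simp
    then show False using p' that unfolding step_nodes_def by fastforce
  qed
  define d where "d k = (\<Sum>i<n. if u i \<le> k \<and> k < u (Suc i) then c i else 0)
      - (\<Sum>i<n'. if u' i \<le> k \<and> k < u' (Suc i) then c' i else 0)" for k
  have swap: "(\<Sum>k<N. (\<Sum>i<m. if v i \<le> k \<and> k < v (Suc i) then e i else 0) * (F (q (Suc k)) - F (q k)))
      = (\<Sum>i<m. e i * (F (r (Suc i)) - F (r i)))"
    if "\<And>i. i < m \<Longrightarrow> v i \<le> v (Suc i)" "\<And>i. i \<le> m \<Longrightarrow> v i \<le> N" "\<And>i. i \<le> m \<Longrightarrow> q (v i) = r i"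
    for m :: nat and v :: "nat \<Rightarrow> nat" and e r :: "nat \<Rightarrow> real" and F :: "real \<Rightarrow> real"
  proof -
    have "(\<Sum>k<N. (\<Sum>i<m. if v i \<le> k \<and> k < v (Suc i) then e i else 0) * (F (q (Suc k)) - F (q k)))
      = (\<Sum>i<m. \<Sum>k<N. (if v i \<le> k \<and> k < v (Suc i) then e i else 0) * (F (q (Suc k)) - F (q k)))"
      unfolding sum_distrib_right by (rule sum.swap)
    also have "\<dots> = (\<Sum>i<m. e i * (F (r (Suc i)) - F (r i)))"
    proof (rule sum.cong[OF refl])
      fix i assume "i \<in> {..<m}"
      then have i: "i < m" by simp
      have "F (r (Suc i)) - F (r i) = F (q (v (Suc i))) - F (q (v i))" using that(3) i by simp
      also have "\<dots> = (\<Sum>k<N. if v i \<le> k \<and> k < v (Suc i) then F (q (Suc k)) - F (q k) else 0)"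
        using that(1)[OF i] that(2)[of "Suc i"] i by (intro sum_increments_refine) auto
      finally show "(\<Sum>k<N. (if v i \<le> k \<and> k < v (Suc i) then e i else 0) * (F (q (Suc k)) - F (q k)))
         = e i * (F (r (Suc i)) - F (r i))"
        by (simp add: sum_distrib_left if_distrib[of "\<lambda>x. x * _"] if_distrib[of "\<lambda>x. _ * x"] cong: if_cong)
    qed
    finally show ?thesis .
  qed
  show ?thesis
  proof (rule that[of N q d])
    have "0 \<le> x" if "x \<in> P" for x
      using that step_nodes_nonneg[OF p] step_nodes_nonneg[OF p'] by (auto simp: P_def)
    then show "step_nodes N q"
      unfolding step_nodes_def using q_P q_mono by auto
    show "(\<Sum>k<N. d k * (F (q (Suc k)) - F (q k)))
       = (\<Sum>k<n. c k * (F (p (Suc k)) - F (p k))) - (\<Sum>k<n'. c' k * (F (p' (Suc k)) - F (p' k)))"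
      for F :: "real \<Rightarrow> real"
      unfolding d_def left_diff_distrib sum_subtractf
      using swap[of n u p c F] swap[of n' u' p' c' F] u u' ui ui' by simp
  qed
qed

lemma step_fun_eq_increments:
  assumes "step_nodes n p"
  shows "step_fun n p c s = (\<Sum>k<n. c k * (of_bool (s \<le> p (Suc k)) - of_bool (s \<le> p k)))"
  unfolding step_fun_def using assms
  by (intro sum.cong refl) (auto simp: step_nodes_def indicator_def; fastforce)

lemma nn_integral_square_tendsto_zero_AE:
  fixes u :: "nat \<Rightarrow> 'a \<Rightarrow> real"
  assumes [measurable]: "\<And>i. u i \<in> borel_measurable M"
    and lim: "(\<lambda>i. \<integral>\<^sup>+\<omega>. ennreal ((u i \<omega>)\<^sup>2) \<partial>M) \<longlonglongrightarrow> 0"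
  obtains r where "strict_mono r" "AE \<omega> in M. (\<lambda>i. u (r i) \<omega>) \<longlonglongrightarrow> 0"
proof -
  have "eventually (\<lambda>i. (\<integral>\<^sup>+\<omega>. ennreal ((u i \<omega>)\<^sup>2) \<partial>M) < 1) sequentially"
    using lim by (rule order_tendstoD) simp
  then obtain N where N: "\<And>i. i \<ge> N \<Longrightarrow> (\<integral>\<^sup>+\<omega>. ennreal ((u i \<omega>)\<^sup>2) \<partial>M) < 1"
    by (auto simp: eventually_sequentially)
  have int: "integrable M (\<lambda>\<omega>. (u (i + N) \<omega>)\<^sup>2)" for i
    using less_trans[OF N[of "i + N"]] by (intro integrableI_bounded) (auto simp: ennreal_one_less_top)
  have "(\<lambda>i. enn2real (\<integral>\<^sup>+\<omega>. ennreal ((u (i + N) \<omega>)\<^sup>2) \<partial>M)) \<longlonglongrightarrow> enn2real 0"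
    using LIMSEQ_ignore_initial_segment[OF lim, of N] by (intro tendsto_enn2real) auto
  moreover have "enn2real (\<integral>\<^sup>+\<omega>. ennreal ((u (i + N) \<omega>)\<^sup>2) \<partial>M) = (\<integral>\<omega>. norm ((u (i + N) \<omega>)\<^sup>2) \<partial>M)" for i
    by (subst integral_eq_nn_integral) auto
  ultimately have "(\<lambda>i. \<integral>\<omega>. norm ((u (i + N) \<omega>)\<^sup>2) \<partial>M) \<longlonglongrightarrow> 0" by simp
  from tendsto_L1_AE_subseq[OF int this] obtain r where r: "strict_mono r"
    and ae: "AE \<omega> in M. (\<lambda>i. (u (r i + N) \<omega>)\<^sup>2) \<longlonglongrightarrow> 0" by blast
  show ?thesis
  proof (rule that[of "\<lambda>i. r i + N"])
    show "strict_mono (\<lambda>i. r i + N)" using r by (auto simp: strict_mono_def)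
    show "AE \<omega> in M. (\<lambda>i. u (r i + N) \<omega>) \<longlonglongrightarrow> 0"
      using ae
    proof eventually_elim
      case (elim \<omega>)
      then show ?case using tendsto_real_sqrt[OF elim] by (simp add: tendsto_rabs_zero_iff)
    qed
  qed
qed

text \<open>The approximating step integrals are normal with variance controlled by the isometry.  They
  converge to \<open>X - Y\<close> almost surely along a subsequence, and Fatou's lemma carries the moment bound to
  the limit.  The factor \<open>6\<close> is
  \<open>3 (1/2 + 1 + 1/2)\<close>, from splitting the square of the difference of the step functions into three.\<close>

lemma wiener_integral_increment_moment:
  assumes B: "standard_brownian_motion M B"
    and X: "has_wiener_integral M B A h X" and Y: "has_wiener_integral M B A' h' Y"
    and V: "V > 0" "(\<integral>\<^sup>+s. ennreal ((indicator A s * h s - indicator A' s * h' s)\<^sup>2) \<partial>lborel) \<le> ennreal V"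
    and m: "m > 0"
  shows "(\<integral>\<^sup>+\<omega>. ennreal ((X \<omega> - Y \<omega>) ^ (2 * m)) \<partial>M) \<le> ennreal (fact (2 * m) / (2 ^ m * fact m) * (6 * V) ^ m)"
proof -
  define a where "a s = indicator A s * h s" for s
  define b where "b s = indicator A' s * h' s" for s
  have [measurable]: "a \<in> borel_measurable borel" "b \<in> borel_measurable borel"
     "X \<in> borel_measurable M" "Y \<in> borel_measurable M"
    using X Y unfolding has_wiener_integral_def a_def b_def by auto
  obtain n p c where p: "\<And>i. step_nodes (n i) (p i)"
    and L: "(\<lambda>i::nat. \<integral>\<^sup>+ s. ennreal ((step_fun (n i) (p i) (c i) s - a s)\<^sup>2) \<partial>lborel) \<longlonglongrightarrow> 0"
    and S: "(\<lambda>i. \<integral>\<^sup>+ \<omega>. ennreal ((step_wiener_integral B (n i) (p i) (c i) \<omega> - X \<omega>)\<^sup>2) \<partial>M) \<longlonglongrightarrow> 0"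
    using X unfolding has_wiener_integral_def a_def by auto
  obtain n' p' c' where p': "\<And>i. step_nodes (n' i) (p' i)"
    and L': "(\<lambda>i::nat. \<integral>\<^sup>+ s. ennreal ((step_fun (n' i) (p' i) (c' i) s - b s)\<^sup>2) \<partial>lborel) \<longlonglongrightarrow> 0"
    and S': "(\<lambda>i. \<integral>\<^sup>+ \<omega>. ennreal ((step_wiener_integral B (n' i) (p' i) (c' i) \<omega> - Y \<omega>)\<^sup>2) \<partial>M) \<longlonglongrightarrow> 0"
    using Y unfolding has_wiener_integral_def b_def by auto
  define \<phi> where "\<phi> i = step_fun (n i) (p i) (c i)" for i
  define \<psi> where "\<psi> i = step_fun (n' i) (p' i) (c' i)" for i
  define U where "U i = step_wiener_integral B (n i) (p i) (c i)" for i
  define U' where "U' i = step_wiener_integral B (n' i) (p' i) (c' i)" for i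
  define Z where "Z i \<omega> = U i \<omega> - U' i \<omega>" for i \<omega>
  define K where "K = (fact (2 * m) / (2 ^ m * fact m) :: real)"
  have [measurable]: "U i \<in> borel_measurable M" "U' i \<in> borel_measurable M" for i
    unfolding U_def U'_def using step_wiener_integral_measurable[OF B] p p' by auto
  have [measurable]: "Z i \<in> borel_measurable M" for i unfolding Z_def[abs_def] by measurable
  have [measurable]: "\<phi> i \<in> borel_measurable borel" "\<psi> i \<in> borel_measurable borel" for i
    unfolding \<phi>_def \<psi>_def by auto
  have Zmom: "(\<integral>\<^sup>+\<omega>. ennreal (Z i \<omega> ^ (2 * m)) \<partial>M) \<le> ennreal (K * W ^ m)"
    if W: "(\<integral>\<^sup>+s. ennreal ((\<phi> i s - \<psi> i s)\<^sup>2) \<partial>lborel) \<le> ennreal W" "W \<ge> 0" for i W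
  proof -
    obtain N q d where q: "step_nodes N q" and eq: "\<And>F :: real \<Rightarrow> real. (\<Sum>k<N. d k * (F (q (Suc k)) - F (q k)))
       = (\<Sum>k<n i. c i k * (F (p i (Suc k)) - F (p i k))) - (\<Sum>k<n' i. c' i k * (F (p' i (Suc k)) - F (p' i k)))"
      using common_refinement[OF p[of i] p'[of i], of "c i" "c' i"] by blast
    have Z: "Z i \<omega> = step_wiener_integral B N q d \<omega>" for \<omega>
      unfolding Z_def U_def U'_def step_wiener_integral_def by (rule eq[symmetric])
    have "\<phi> i s - \<psi> i s = step_fun N q d s" for s
      unfolding \<phi>_def \<psi>_def step_fun_eq_increments[OF p] step_fun_eq_increments[OF p'] step_fun_eq_increments[OF q]
      by (rule eq[symmetric])
    then have "ennreal (\<Sum>k<N. (d k)\<^sup>2 * (q (Suc k) - q k)) \<le> ennreal W"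
      using W(1) step_fun_isometry[OF q, of d] by simp
    then have le: "(\<Sum>k<N. (d k)\<^sup>2 * (q (Suc k) - q k)) \<le> W" using W(2) by (simp add: ennreal_le_iff)
    have "0 \<le> (\<Sum>k<N. (d k)\<^sup>2 * (q (Suc k) - q k))"
      using q by (intro sum_nonneg) (auto simp: step_nodes_def less_imp_le)
    then show ?thesis
      unfolding Z step_wiener_integral_even_moment[OF B q m] K_def
      using le by (intro ennreal_leI mult_left_mono power_mono) auto
  qed
  have ev: "eventually (\<lambda>i. (\<integral>\<^sup>+\<omega>. ennreal (Z i \<omega> ^ (2 * m)) \<partial>M) \<le> ennreal (K * (6 * V) ^ m)) sequentially"
  proof -
    have "eventually (\<lambda>i. (\<integral>\<^sup>+ s. ennreal ((\<phi> i s - a s)\<^sup>2) \<partial>lborel) < ennreal (V / 2)) sequentially"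
      "eventually (\<lambda>i. (\<integral>\<^sup>+ s. ennreal ((\<psi> i s - b s)\<^sup>2) \<partial>lborel) < ennreal (V / 2)) sequentially"
      using V by (auto intro!: order_tendstoD(2)[OF L[folded \<phi>_def]] order_tendstoD(2)[OF L'[folded \<psi>_def]])
    then show ?thesis
    proof eventually_elim
      case (elim i)
      have "(\<phi> i s - \<psi> i s)\<^sup>2 \<le> 3 * (\<phi> i s - a s)\<^sup>2 + 3 * (a s - b s)\<^sup>2 + 3 * (\<psi> i s - b s)\<^sup>2" for s
      proof -
        have three: "(x + y - z)\<^sup>2 \<le> 3 * x\<^sup>2 + 3 * y\<^sup>2 + 3 * z\<^sup>2" for x y z :: real
        proof -
          have "0 \<le> (x - y)\<^sup>2 + (x + z)\<^sup>2 + (y + z)\<^sup>2" by simp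
          then show ?thesis by (simp add: power2_eq_square algebra_simps)
        qed
        show ?thesis using three[of "\<phi> i s - a s" "a s - b s" "\<psi> i s - b s"] by simp
      qed
      then have "(\<integral>\<^sup>+s. ennreal ((\<phi> i s - \<psi> i s)\<^sup>2) \<partial>lborel)
         \<le> (\<integral>\<^sup>+s. 3 * ennreal ((\<phi> i s - a s)\<^sup>2) + 3 * ennreal ((a s - b s)\<^sup>2) + 3 * ennreal ((\<psi> i s - b s)\<^sup>2) \<partial>lborel)"
        by (intro nn_integral_mono) (simp add: ennreal_mult'[symmetric] ennreal_plus[symmetric] ennreal_numeral[symmetric] ennreal_leI del: ennreal_plus ennreal_numeral)
      also have "\<dots> = 3 * (\<integral>\<^sup>+s. ennreal ((\<phi> i s - a s)\<^sup>2) \<partial>lborel) + 3 * (\<integral>\<^sup>+s. ennreal ((a s - b s)\<^sup>2) \<partial>lborel)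
          + 3 * (\<integral>\<^sup>+s. ennreal ((\<psi> i s - b s)\<^sup>2) \<partial>lborel)"
        by (simp add: nn_integral_add nn_integral_cmult)
      also have "\<dots> \<le> 3 * ennreal (V / 2) + 3 * ennreal V + 3 * ennreal (V / 2)"
        using elim V(2) unfolding a_def b_def by (intro add_mono mult_left_mono) auto
      also have "\<dots> = ennreal (6 * V)"
        using V(1) by (simp add: ennreal_mult'[symmetric] ennreal_plus[symmetric] ennreal_numeral[symmetric] del: ennreal_plus ennreal_numeral)
      finally show ?case by (intro Zmom) (use V in auto)
    qed
  qed
  have D: "(\<lambda>i. \<integral>\<^sup>+\<omega>. ennreal ((Z i \<omega> - (X \<omega> - Y \<omega>))\<^sup>2) \<partial>M) \<longlonglongrightarrow> 0"
  proof (rule tendsto_sandwich[OF _ _ tendsto_const])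
    have "(\<lambda>i. 2 * (\<integral>\<^sup>+\<omega>. ennreal ((U i \<omega> - X \<omega>)\<^sup>2) \<partial>M) + 2 * (\<integral>\<^sup>+\<omega>. ennreal ((U' i \<omega> - Y \<omega>)\<^sup>2) \<partial>M)) \<longlonglongrightarrow> 2 * 0 + 2 * 0"
      unfolding U_def U'_def by (intro tendsto_add ennreal_tendsto_cmult S S') auto
    then show "(\<lambda>i. 2 * (\<integral>\<^sup>+\<omega>. ennreal ((U i \<omega> - X \<omega>)\<^sup>2) \<partial>M) + 2 * (\<integral>\<^sup>+\<omega>. ennreal ((U' i \<omega> - Y \<omega>)\<^sup>2) \<partial>M)) \<longlonglongrightarrow> 0"
      by simp
    show "\<forall>\<^sub>F i in sequentially. (\<integral>\<^sup>+\<omega>. ennreal ((Z i \<omega> - (X \<omega> - Y \<omega>))\<^sup>2) \<partial>M)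
       \<le> 2 * (\<integral>\<^sup>+\<omega>. ennreal ((U i \<omega> - X \<omega>)\<^sup>2) \<partial>M) + 2 * (\<integral>\<^sup>+\<omega>. ennreal ((U' i \<omega> - Y \<omega>)\<^sup>2) \<partial>M)"
    proof (intro always_eventually allI)
      fix i
      have "(Z i \<omega> - (X \<omega> - Y \<omega>))\<^sup>2 \<le> 2 * (U i \<omega> - X \<omega>)\<^sup>2 + 2 * (U' i \<omega> - Y \<omega>)\<^sup>2" for \<omega>
      proof -
        have two: "(x - y)\<^sup>2 \<le> 2 * x\<^sup>2 + 2 * y\<^sup>2" for x y :: real
          using zero_le_power2[of "x + y"] by (simp add: power2_eq_square algebra_simps)
        have "Z i \<omega> - (X \<omega> - Y \<omega>) = (U i \<omega> - X \<omega>) - (U' i \<omega> - Y \<omega>)" by (simp add: Z_def)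
        then show ?thesis using two by metis
      qed
      then have "(\<integral>\<^sup>+\<omega>. ennreal ((Z i \<omega> - (X \<omega> - Y \<omega>))\<^sup>2) \<partial>M) \<le> (\<integral>\<^sup>+\<omega>. 2 * ennreal ((U i \<omega> - X \<omega>)\<^sup>2) + 2 * ennreal ((U' i \<omega> - Y \<omega>)\<^sup>2) \<partial>M)"
        by (intro nn_integral_mono) (simp add: ennreal_mult'[symmetric] ennreal_plus[symmetric] ennreal_numeral[symmetric] ennreal_leI del: ennreal_plus ennreal_numeral)
      also have "\<dots> = 2 * (\<integral>\<^sup>+\<omega>. ennreal ((U i \<omega> - X \<omega>)\<^sup>2) \<partial>M) + 2 * (\<integral>\<^sup>+\<omega>. ennreal ((U' i \<omega> - Y \<omega>)\<^sup>2) \<partial>M)"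
        by (simp add: nn_integral_add nn_integral_cmult)
      finally show "(\<integral>\<^sup>+\<omega>. ennreal ((Z i \<omega> - (X \<omega> - Y \<omega>))\<^sup>2) \<partial>M)
       \<le> 2 * (\<integral>\<^sup>+\<omega>. ennreal ((U i \<omega> - X \<omega>)\<^sup>2) \<partial>M) + 2 * (\<integral>\<^sup>+\<omega>. ennreal ((U' i \<omega> - Y \<omega>)\<^sup>2) \<partial>M)" .
    qed
  qed auto
  obtain r where r: "strict_mono r" and ae: "AE \<omega> in M. (\<lambda>i. Z (r i) \<omega> - (X \<omega> - Y \<omega>)) \<longlonglongrightarrow> 0"
    using nn_integral_square_tendsto_zero_AE[OF _ D] by auto
  have "(\<integral>\<^sup>+\<omega>. ennreal ((X \<omega> - Y \<omega>) ^ (2 * m)) \<partial>M) = (\<integral>\<^sup>+\<omega>. liminf (\<lambda>i. ennreal (Z (r i) \<omega> ^ (2 * m))) \<partial>M)"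
  proof (rule nn_integral_cong_AE)
    show "AE \<omega> in M. ennreal ((X \<omega> - Y \<omega>) ^ (2 * m)) = liminf (\<lambda>i. ennreal (Z (r i) \<omega> ^ (2 * m)))"
      using ae
    proof eventually_elim
      case (elim \<omega>)
      then have "(\<lambda>i. Z (r i) \<omega>) \<longlonglongrightarrow> X \<omega> - Y \<omega>" by (subst LIM_zero_iff[symmetric])
      then have "(\<lambda>i. ennreal (Z (r i) \<omega> ^ (2 * m))) \<longlonglongrightarrow> ennreal ((X \<omega> - Y \<omega>) ^ (2 * m))"
        by (intro tendsto_ennrealI tendsto_power)
      then show ?case by (intro lim_imp_Liminf[symmetric]) auto
    qed
  qed
  also have "\<dots> \<le> liminf (\<lambda>i. \<integral>\<^sup>+\<omega>. ennreal (Z (r i) \<omega> ^ (2 * m)) \<partial>M)"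
    by (intro nn_integral_liminf) measurable
  also have "\<dots> \<le> liminf (\<lambda>i::nat. ennreal (K * (6 * V) ^ m))"
    using filterlim_subseq[OF r] ev by (intro Liminf_mono) (auto simp: filterlim_iff)
  also have "\<dots> = ennreal (K * (6 * V) ^ m)" by (simp add: Liminf_const)
  finally show ?thesis by (simp add: K_def)
qed

section \<open>The Hadamard kernel\<close>

text \<open>The integrand of \<open>H t\<close> up to the factor \<open>1 / sqrt (Gamma \<alpha>)\<close>.  It vanishes for \<open>t = 0\<close>, in
  accordance with \<open>H 0 = 0\<close>, so increments from the origin need no separate treatment.\<close>

definition hadamard_kernel :: "real \<Rightarrow> real \<Rightarrow> real \<Rightarrow> real" where
  "hadamard_kernel \<alpha> t s = indicator {0<..<t} s * ln (t / s) powr ((\<alpha> - 1) / 2)"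

lemma hadamard_kernel_measurable [measurable]: "hadamard_kernel \<alpha> t \<in> borel_measurable borel"
  unfolding hadamard_kernel_def[abs_def] by measurable

lemma hadamard_kernel_nonneg: "0 \<le> hadamard_kernel \<alpha> t s"
  by (simp add: hadamard_kernel_def)

lemma hadamard_kernel_square:
  "(hadamard_kernel \<alpha> t s)\<^sup>2 = indicator {0<..<t} s * ln (t / s) powr (\<alpha> - 1)"
  by (simp add: hadamard_kernel_def power2_eq_square indicator_def flip: powr_add)

text \<open>The kernel is a function of \<open>s / t\<close>, so its squared norm is proportional to \<open>t\<close>.\<close>

lemma hadamard_kernel_norm_scaling:
  assumes "t > 0"
  shows "(\<integral>\<^sup>+s. ennreal ((hadamard_kernel \<alpha> t s)\<^sup>2) \<partial>lborel)
     = ennreal t * (\<integral>\<^sup>+s. ennreal ((hadamard_kernel \<alpha> 1 s)\<^sup>2) \<partial>lborel)"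
proof -
  have "hadamard_kernel \<alpha> t (t * x) = hadamard_kernel \<alpha> 1 x" for x
    using assms by (auto simp: hadamard_kernel_def indicator_def zero_less_mult_iff)
  then show ?thesis
    using assms nn_integral_real_affine[of "\<lambda>s. ennreal ((hadamard_kernel \<alpha> t s)\<^sup>2)" t 0] by simp
qed

text \<open>On the diagonal the kernel behaves like a power: \<open>ln (t / u) \<ge> (t - u) / t\<close>, and the exponent
  \<open>\<alpha> - 1\<close> is negative.\<close>

lemma hadamard_kernel_tail:
  assumes "0 < \<alpha>" "\<alpha> < 1" "0 \<le> s" "s < t"
  shows "(\<integral>\<^sup>+u. ennreal (indicator {s..} u * (hadamard_kernel \<alpha> t u)\<^sup>2) \<partial>lborel)
     \<le> ennreal (t powr (1 - \<alpha>) * ((t - s) powr \<alpha> / \<alpha>))"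
proof -
  have "indicator {s..} u * (hadamard_kernel \<alpha> t u)\<^sup>2
      \<le> t powr (1 - \<alpha>) * (indicator {0..t - s} (t - u) * (t - u) powr (\<alpha> - 1))" for u
  proof (cases "s \<le> u \<and> 0 < u \<and> u < t")
    case True
    have "ln (u / t) \<le> u / t - 1" using True by (intro ln_le_minus_one) auto
    then have "(t - u) / t \<le> ln (t / u)" using True by (simp add: ln_div diff_divide_distrib)
    then have "ln (t / u) powr (\<alpha> - 1) \<le> ((t - u) / t) powr (\<alpha> - 1)"
      using True assms by (intro powr_mono2') auto
    also have "\<dots> = t powr (1 - \<alpha>) * (t - u) powr (\<alpha> - 1)"
      using True by (simp add: powr_divide powr_minus_divide[of t "\<alpha> - 1", simplified] field_simps flip: powr_add)
    finally show ?thesis using True by (simp add: hadamard_kernel_square)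
  next
    case False
    then have "indicator {s..} u * (hadamard_kernel \<alpha> t u)\<^sup>2 = 0"
      by (auto simp: hadamard_kernel_square indicator_def)
    moreover have "0 \<le> t powr (1 - \<alpha>) * (indicator {0..t - s} (t - u) * (t - u) powr (\<alpha> - 1))"
      by simp
    ultimately show ?thesis by linarith
  qed
  then have "(\<integral>\<^sup>+u. ennreal (indicator {s..} u * (hadamard_kernel \<alpha> t u)\<^sup>2) \<partial>lborel)
     \<le> (\<integral>\<^sup>+u. ennreal (t powr (1 - \<alpha>)) * ennreal (indicator {0..t - s} (t - u) * (t - u) powr (\<alpha> - 1)) \<partial>lborel)"
    by (intro nn_integral_mono) (simp add: ennreal_leI flip: ennreal_mult')
  also have "\<dots> = ennreal (t powr (1 - \<alpha>)) * (\<integral>\<^sup>+u. ennreal (indicator {0..t - s} (t - u) * (t - u) powr (\<alpha> - 1)) \<partial>lborel)"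
    by (intro nn_integral_cmult) measurable
  also have "(\<integral>\<^sup>+u. ennreal (indicator {0..t - s} (t - u) * (t - u) powr (\<alpha> - 1)) \<partial>lborel)
     = (\<integral>\<^sup>+x. ennreal (indicator {0..t - s} x * x powr (\<alpha> - 1)) \<partial>lborel)"
    using nn_integral_real_affine[of "\<lambda>x. ennreal (indicator {0..t - s} x * x powr (\<alpha> - 1))" "-1" t] by simp
  also have "\<dots> = ennreal ((t - s) powr \<alpha> / \<alpha>)"
    using has_integral_powr_from_0[of "\<alpha> - 1" "t - s"] assms
    by (intro nn_integral_has_integral_lebesgue) auto
  also have "ennreal (t powr (1 - \<alpha>)) * ennreal ((t - s) powr \<alpha> / \<alpha>)
      = ennreal (t powr (1 - \<alpha>) * ((t - s) powr \<alpha> / \<alpha>))"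
    by (rule ennreal_mult'[symmetric]) simp
  finally show ?thesis .
qed

text \<open>For \<open>\<alpha> < 1\<close> the singularity at \<open>s = 1\<close> is integrable by the tail estimate; for \<open>\<alpha> > 1\<close> the one
  at \<open>s = 0\<close> is integrable because \<open>ln (1 / s) \<le> 1 / s\<close> and \<open>1 - \<alpha> > -1\<close>.\<close>

lemma hadamard_kernel_norm_finite:
  assumes "\<alpha> \<in> {0<..<1} \<union> {1<..<2}"
  shows "(\<integral>\<^sup>+s. ennreal ((hadamard_kernel \<alpha> 1 s)\<^sup>2) \<partial>lborel) < \<infinity>"
proof (cases "\<alpha> < 1")
  case True
  have "(hadamard_kernel \<alpha> 1 u)\<^sup>2 = indicator {0..} u * (hadamard_kernel \<alpha> 1 u)\<^sup>2" for u
    by (auto simp: hadamard_kernel_square indicator_def)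
  then have "(\<integral>\<^sup>+s. ennreal ((hadamard_kernel \<alpha> 1 s)\<^sup>2) \<partial>lborel)
      = (\<integral>\<^sup>+u. ennreal (indicator {0..} u * (hadamard_kernel \<alpha> 1 u)\<^sup>2) \<partial>lborel)"
    by (intro nn_integral_cong arg_cong[where f=ennreal])
  also have "\<dots> \<le> ennreal (1 powr (1 - \<alpha>) * ((1 - 0) powr \<alpha> / \<alpha>))"
    using True assms by (intro hadamard_kernel_tail) auto
  also have "\<dots> < \<infinity>" by simp
  finally show ?thesis .
next
  case False
  then have \<alpha>: "1 < \<alpha>" "\<alpha> < 2" using assms by auto
  have "(hadamard_kernel \<alpha> 1 u)\<^sup>2 \<le> indicator {0..1} u * u powr (1 - \<alpha>)" for u
  proof (cases "0 < u \<and> u < 1")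
    case True
    have "ln (1 / u) \<le> 1 / u" using True by (intro ln_bound) auto
    then have "ln (1 / u) powr (\<alpha> - 1) \<le> (1 / u) powr (\<alpha> - 1)"
      using True \<alpha> by (intro powr_mono2) auto
    also have "\<dots> = u powr (1 - \<alpha>)"
      using True by (simp add: powr_divide powr_minus_divide[of u "\<alpha> - 1", simplified])
    finally show ?thesis using True by (simp add: hadamard_kernel_square)
  next
    case False
    then have "(hadamard_kernel \<alpha> 1 u)\<^sup>2 = 0" by (auto simp: hadamard_kernel_square indicator_def)
    then show ?thesis by simp
  qed
  then have "(\<integral>\<^sup>+s. ennreal ((hadamard_kernel \<alpha> 1 s)\<^sup>2) \<partial>lborel)
     \<le> (\<integral>\<^sup>+u. ennreal (indicator {0..1} u * u powr (1 - \<alpha>)) \<partial>lborel)"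
    by (intro nn_integral_mono ennreal_leI)
  also have "\<dots> = ennreal (1 powr (1 - \<alpha> + 1) / (1 - \<alpha> + 1))"
    using has_integral_powr_from_0[of "1 - \<alpha>" 1] \<alpha>
    by (intro nn_integral_has_integral_lebesgue) auto
  also have "\<dots> < \<infinity>" by simp
  finally show ?thesis .
qed

lemma hadamard_kernel_norm:
  assumes "\<alpha> \<in> {0<..<1} \<union> {1<..<2}"
  obtains c where "c \<ge> 0" "\<And>t. t \<ge> 0 \<Longrightarrow> (\<integral>\<^sup>+s. ennreal ((hadamard_kernel \<alpha> t s)\<^sup>2) \<partial>lborel) = ennreal (t * c)"
proof -
  define c where "c = enn2real (\<integral>\<^sup>+s. ennreal ((hadamard_kernel \<alpha> 1 s)\<^sup>2) \<partial>lborel)"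
  have c: "(\<integral>\<^sup>+s. ennreal ((hadamard_kernel \<alpha> 1 s)\<^sup>2) \<partial>lborel) = ennreal c"
    using hadamard_kernel_norm_finite[OF assms] by (simp add: c_def)
  show ?thesis
  proof (rule that[of c])
    show "c \<ge> 0" by (simp add: c_def)
    fix t :: real assume "t \<ge> 0"
    show "(\<integral>\<^sup>+s. ennreal ((hadamard_kernel \<alpha> t s)\<^sup>2) \<partial>lborel) = ennreal (t * c)"
    proof (cases "t = 0")
      case True then show ?thesis by (simp add: hadamard_kernel_def)
    next
      case False
      then show ?thesis using \<open>t \<ge> 0\<close> c hadamard_kernel_norm_scaling[of t \<alpha>] by (simp add: ennreal_mult')
    qed
  qed
qed

text \<open>The squared norm of \<open>k\<^sub>t - k\<^sub>s\<close> is of order \<open>\<bar>t - s\<bar> powr min \<alpha> 1\<close> on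
  bounded time intervals.  Both cases rest on
  \<open>(x - y)\<^sup>2 + y\<^sup>2 \<le> x\<^sup>2\<close> for \<open>0 \<le> y \<le> x\<close> and on the squared norm of \<open>k\<^sub>t\<close> being \<open>c t\<close>.
  If \<open>\<alpha> > 1\<close>, the kernel increases in \<open>t\<close>, which gives \<open>\<parallel>k\<^sub>t - k\<^sub>s\<parallel>\<^sup>2 \<le> c (t - s)\<close>.  If \<open>\<alpha> < 1\<close>, it
  decreases in \<open>t\<close> on \<open>{0<..<s}\<close>; the squared norms there decrease, and only the tail of \<open>k\<^sub>t\<close> on
  \<open>{s..<t}\<close> is left, counted twice.\<close>

lemma hadamard_kernel_increment:
  assumes \<alpha>: "\<alpha> \<in> {0<..<1} \<union> {1<..<2}" and "T > 0"
  obtains C where "C > 0" "\<And>s t. 0 \<le> s \<Longrightarrow> s < t \<Longrightarrow> t \<le> T \<Longrightarrow>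
    (\<integral>\<^sup>+u. ennreal ((hadamard_kernel \<alpha> t u - hadamard_kernel \<alpha> s u)\<^sup>2) \<partial>lborel)
      \<le> ennreal (C * (t - s) powr min \<alpha> 1)"
proof -
  let ?k = "hadamard_kernel \<alpha>"
  obtain c where c: "c \<ge> 0" "\<And>t. t \<ge> 0 \<Longrightarrow> (\<integral>\<^sup>+u. ennreal ((?k t u)\<^sup>2) \<partial>lborel) = ennreal (t * c)"
    using hadamard_kernel_norm[OF \<alpha>] by blast
  show ?thesis
  proof (cases "\<alpha> < 1")
    case False
    then have \<alpha>1: "1 < \<alpha>" "min \<alpha> 1 = 1" using \<alpha> by auto
    have "(\<integral>\<^sup>+u. ennreal ((?k t u - ?k s u)\<^sup>2) \<partial>lborel) \<le> ennreal ((c + 1) * (t - s))"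
      if st: "0 \<le> s" "s < t" for s t
    proof -
      have "(?k t u - ?k s u)\<^sup>2 + (?k s u)\<^sup>2 \<le> (?k t u)\<^sup>2" for u
      proof -
        have "?k s u \<le> ?k t u"
        proof (cases "0 < u \<and> u < s")
          case True
          then have "ln (s / u) powr ((\<alpha> - 1) / 2) \<le> ln (t / u) powr ((\<alpha> - 1) / 2)"
            using st \<alpha>1 by (intro powr_mono2) (auto simp: divide_right_mono)
          then show ?thesis using True st by (simp add: hadamard_kernel_def)
        qed (auto simp: hadamard_kernel_def indicator_def)
        then have "?k s u * ?k s u \<le> ?k s u * ?k t u"
          by (intro mult_left_mono hadamard_kernel_nonneg)
        then show ?thesis by (simp add: power2_eq_square algebra_simps)
      qed
      then have "(\<integral>\<^sup>+u. ennreal ((?k t u - ?k s u)\<^sup>2) + ennreal ((?k s u)\<^sup>2) \<partial>lborel) \<le> (\<integral>\<^sup>+u. ennreal ((?k t u)\<^sup>2) \<partial>lborel)"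
        by (intro nn_integral_mono) (simp add: ennreal_leI flip: ennreal_plus)
      then have "(\<integral>\<^sup>+u. ennreal ((?k t u - ?k s u)\<^sup>2) \<partial>lborel) + ennreal (s * c) \<le> ennreal (t * c)"
        using st by (simp add: nn_integral_add c)
      also have "\<dots> = ennreal ((t - s) * c) + ennreal (s * c)"
        using st c by (simp add: left_diff_distrib mult_right_mono flip: ennreal_plus)
      finally have "(\<integral>\<^sup>+u. ennreal ((?k t u - ?k s u)\<^sup>2) \<partial>lborel) \<le> ennreal ((t - s) * c)"
        by (simp add: ennreal_add_left_cancel_le add.commute)
      also have "\<dots> \<le> ennreal ((c + 1) * (t - s))"
        using st by (intro ennreal_leI) (simp add: algebra_simps)
      finally show ?thesis .
    qed
    then show ?thesis using c(1) \<alpha>1 by (intro that[of "c + 1"]) auto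
  next
    case True
    then have \<alpha>1: "0 < \<alpha>" "\<alpha> < 1" "min \<alpha> 1 = \<alpha>" using \<alpha> by auto
    define C where "C = 2 * (T powr (1 - \<alpha>) / \<alpha>)"
    have C: "C > 0" using \<alpha>1 \<open>T > 0\<close> by (simp add: C_def)
    have "(\<integral>\<^sup>+u. ennreal ((?k t u - ?k s u)\<^sup>2) \<partial>lborel) \<le> ennreal (C * (t - s) powr \<alpha>)"
      if st: "0 \<le> s" "s < t" "t \<le> T" for s t
    proof -
      have "(?k t u - ?k s u)\<^sup>2 + (?k t u)\<^sup>2 \<le> (?k s u)\<^sup>2 + 2 * (indicator {s..} u * (?k t u)\<^sup>2)" for u
      proof (cases "0 < u \<and> u < s")
        case True
        then have "ln (t / u) powr ((\<alpha> - 1) / 2) \<le> ln (s / u) powr ((\<alpha> - 1) / 2)"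
          using st \<alpha>1 by (intro powr_mono2') (auto simp: divide_right_mono)
        then have "?k t u \<le> ?k s u" using True st by (simp add: hadamard_kernel_def)
        then have "?k t u * ?k t u \<le> ?k t u * ?k s u"
          by (intro mult_left_mono hadamard_kernel_nonneg)
        then have "(?k t u - ?k s u)\<^sup>2 + (?k t u)\<^sup>2 \<le> (?k s u)\<^sup>2"
          by (simp add: power2_eq_square algebra_simps)
        then show ?thesis by (simp add: add_increasing2)
      next
        case False
        then have "?k s u = 0" "?k t u = indicator {s..} u * ?k t u"
          using st by (auto simp: hadamard_kernel_def indicator_def)
        then show ?thesis by (auto simp: indicator_def)
      qed
      then have "(\<integral>\<^sup>+u. ennreal ((?k t u - ?k s u)\<^sup>2) + ennreal ((?k t u)\<^sup>2) \<partial>lborel)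
         \<le> (\<integral>\<^sup>+u. ennreal ((?k s u)\<^sup>2) + 2 * ennreal (indicator {s..} u * (?k t u)\<^sup>2) \<partial>lborel)"
        by (intro nn_integral_mono)
          (simp add: ennreal_leI ennreal_mult'[symmetric] ennreal_plus[symmetric] ennreal_numeral[symmetric] del: ennreal_plus ennreal_numeral)
      then have "(\<integral>\<^sup>+u. ennreal ((?k t u - ?k s u)\<^sup>2) \<partial>lborel) + ennreal (t * c)
         \<le> ennreal (s * c) + 2 * (\<integral>\<^sup>+u. ennreal (indicator {s..} u * (?k t u)\<^sup>2) \<partial>lborel)"
        using st by (simp add: nn_integral_add nn_integral_cmult c)
      also have "\<dots> \<le> ennreal (t * c) + 2 * ennreal (T powr (1 - \<alpha>) * ((t - s) powr \<alpha> / \<alpha>))"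
      proof (intro add_mono mult_left_mono)
        show "ennreal (s * c) \<le> ennreal (t * c)"
          using st c by (intro ennreal_leI mult_right_mono) auto
        have "t powr (1 - \<alpha>) * ((t - s) powr \<alpha> / \<alpha>) \<le> T powr (1 - \<alpha>) * ((t - s) powr \<alpha> / \<alpha>)"
          using st \<alpha>1 by (intro mult_right_mono powr_mono2) auto
        then show "(\<integral>\<^sup>+u. ennreal (indicator {s..} u * (?k t u)\<^sup>2) \<partial>lborel) \<le> ennreal (T powr (1 - \<alpha>) * ((t - s) powr \<alpha> / \<alpha>))"
          using hadamard_kernel_tail[OF \<alpha>1(1,2) st(1,2)] by (meson ennreal_leI order_trans)
      qed auto
      also have "2 * ennreal (T powr (1 - \<alpha>) * ((t - s) powr \<alpha> / \<alpha>)) = ennreal (C * (t - s) powr \<alpha>)"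
        using \<alpha>1 by (simp add: C_def ennreal_mult'[symmetric] ennreal_numeral[symmetric] mult_ac del: ennreal_numeral)
      finally show ?thesis by (simp add: ennreal_add_left_cancel_le add.commute)
    qed
    then show ?thesis using C \<alpha>1 by (intro that[of C]) auto
  qed
qed

section \<open>Path regularity\<close>

text \<open>Kolmogorov's criterion for a process with continuous paths.  The sum \<open>S\<close> of the powers
  \<open>(2 powr (\<gamma> n) * increment) ^ (2 m)\<close> over all dyadic increments of all levels has finite expectation,
  since level \<open>n\<close> contributes \<open>2 ^ n\<close> terms and in total a multiple of \<open>\<rho> ^ n\<close> with
  \<open>\<rho> = 2 powr (2 m \<gamma> + 1 - r) < 1\<close>.  Hence \<open>S\<close> is almost surely finite, and a finite \<open>S\<close> bounds every
  single weighted increment, which is the hypothesis of the chaining lemma.\<close>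

lemma kolmogorov_dyadic_holder:
  fixes X :: "real \<Rightarrow> 'a \<Rightarrow> real"
  assumes "T > 0" "C \<ge> 0" "\<gamma> > 0" and r: "2 * real m * \<gamma> < r - 1" and m: "m > 0"
    and meas: "\<And>t. 0 \<le> t \<Longrightarrow> X t \<in> borel_measurable M"
    and mom: "\<And>s t. 0 \<le> s \<Longrightarrow> s < t \<Longrightarrow> t \<le> T \<Longrightarrow>
      (\<integral>\<^sup>+\<omega>. ennreal ((X t \<omega> - X s \<omega>) ^ (2 * m)) \<partial>M) \<le> ennreal (C * (t - s) powr r)"
    and cont: "AE \<omega> in M. continuous_on {0..} (\<lambda>t. X t \<omega>)"
  shows "AE \<omega> in M. holder_continuous_on {0..T} \<gamma> (\<lambda>t. X t \<omega>)"
proof -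
  define I where "I n k \<omega> = X (real (Suc k) * T / 2 ^ n) \<omega> - X (real k * T / 2 ^ n) \<omega>" for n k :: nat and \<omega>
  define w where "w n = 2 powr (\<gamma> * real n)" for n :: nat
  define S where "S \<omega> = (\<Sum>n. \<Sum>k<2 ^ n. ennreal ((w n * I n k \<omega>) ^ (2 * m)))" for \<omega>
  define \<rho> where "\<rho> = 2 powr (2 * real m * \<gamma> + 1 - r)"
  have \<rho>: "0 < \<rho>" "\<rho> < 1" using r by (auto simp: \<rho>_def powr_less_one)
  have [measurable]: "I n k \<in> borel_measurable M" for n k
    unfolding I_def[abs_def] using \<open>T > 0\<close> by (intro borel_measurable_diff meas) auto
  have term_le: "(\<integral>\<^sup>+\<omega>. ennreal ((w n * I n k \<omega>) ^ (2 * m)) \<partial>M) \<le> ennreal (w n ^ (2 * m) * (C * (T / 2 ^ n) powr r))"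
    if "k < 2 ^ n" for n k
  proof -
    have "real (Suc k) \<le> 2 ^ n"
      using that by (metis Suc_leI of_nat_le_iff of_nat_numeral of_nat_power)
    then have "real (Suc k) * T \<le> 2 ^ n * T" using \<open>T > 0\<close> by (intro mult_right_mono) auto
    then have le: "real (Suc k) * T / 2 ^ n \<le> T" by (simp add: divide_le_eq mult.commute)
    have diff: "real (Suc k) * T / 2 ^ n - real k * T / 2 ^ n = T / 2 ^ n"
      by (simp add: field_simps)
    have lt: "real k * T / 2 ^ n < real (Suc k) * T / 2 ^ n"
      using \<open>T > 0\<close> by (simp add: divide_strict_right_mono)
    have "(\<integral>\<^sup>+\<omega>. ennreal ((w n * I n k \<omega>) ^ (2 * m)) \<partial>M)
       = (\<integral>\<^sup>+\<omega>. ennreal (w n ^ (2 * m)) * ennreal (I n k \<omega> ^ (2 * m)) \<partial>M)"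
      by (simp add: power_mult_distrib ennreal_mult' w_def)
    also have "\<dots> = ennreal (w n ^ (2 * m)) * (\<integral>\<^sup>+\<omega>. ennreal (I n k \<omega> ^ (2 * m)) \<partial>M)"
      by (intro nn_integral_cmult) measurable
    also have "\<dots> \<le> ennreal (w n ^ (2 * m)) * ennreal (C * (T / 2 ^ n) powr r)"
      unfolding I_def using mom[OF _ lt le] \<open>T > 0\<close> unfolding diff by (intro mult_left_mono) auto
    also have "\<dots> = ennreal (w n ^ (2 * m) * (C * (T / 2 ^ n) powr r))"
      by (simp add: ennreal_mult' w_def)
    finally show ?thesis .
  qed
  have geom: "2 ^ n * (w n ^ (2 * m) * (C * (T / 2 ^ n) powr r)) = C * T powr r * \<rho> ^ n" for n
  proof -
    have "w n ^ (2 * m) = 2 powr (2 * real m * \<gamma> * real n)"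
      by (simp add: w_def powr_power mult_ac)
    moreover have "(T / 2 ^ n) powr r = T powr r * 2 powr (- r * real n)"
      using \<open>T > 0\<close> by (simp add: powr_divide powr_powr powr_minus_divide mult_ac flip: powr_realpow)
    moreover have "(2::real) ^ n = 2 powr real n" by (simp add: powr_realpow)
    moreover have "\<rho> ^ n = 2 powr (real n + (2 * real m * \<gamma> * real n + (- r * real n)))"
      by (simp add: \<rho>_def powr_power algebra_simps)
    ultimately show ?thesis by (simp only: powr_add mult_ac)
  qed
  have "(\<integral>\<^sup>+\<omega>. S \<omega> \<partial>M) = (\<Sum>n. \<integral>\<^sup>+\<omega>. (\<Sum>k<2 ^ n. ennreal ((w n * I n k \<omega>) ^ (2 * m))) \<partial>M)"
    unfolding S_def by (rule nn_integral_suminf) measurable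
  also have "\<dots> = (\<Sum>n. \<Sum>k<2 ^ n. \<integral>\<^sup>+\<omega>. ennreal ((w n * I n k \<omega>) ^ (2 * m)) \<partial>M)"
    by (intro suminf_cong nn_integral_sum) measurable
  also have "\<dots> \<le> (\<Sum>n. ennreal (C * T powr r * \<rho> ^ n))"
  proof (intro suminf_le allI summableI)
    fix n
    have "(\<Sum>k<2 ^ n. \<integral>\<^sup>+\<omega>. ennreal ((w n * I n k \<omega>) ^ (2 * m)) \<partial>M)
      \<le> (\<Sum>k<(2::nat) ^ n. ennreal (w n ^ (2 * m) * (C * (T / 2 ^ n) powr r)))"
      by (intro sum_mono term_le) auto
    also have "\<dots> = ennreal (2 ^ n * (w n ^ (2 * m) * (C * (T / 2 ^ n) powr r)))"
      by (simp add: ennreal_mult'' ennreal_of_nat_eq_real_of_nat[symmetric] w_def ennreal_power[symmetric] \<open>C \<ge> 0\<close>)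
    finally show "(\<Sum>k<2 ^ n. \<integral>\<^sup>+\<omega>. ennreal ((w n * I n k \<omega>) ^ (2 * m)) \<partial>M) \<le> ennreal (C * T powr r * \<rho> ^ n)"
      unfolding geom .
  qed
  also have "\<dots> = ennreal (\<Sum>n. C * T powr r * \<rho> ^ n)"
    using \<rho> \<open>C \<ge> 0\<close> by (intro suminf_ennreal2 summable_mult summable_geometric) auto
  also have "\<dots> < \<infinity>" by simp
  finally have "(\<integral>\<^sup>+\<omega>. S \<omega> \<partial>M) \<noteq> \<infinity>" by simp
  moreover have "S \<in> borel_measurable M" unfolding S_def[abs_def] by measurable
  ultimately have "AE \<omega> in M. S \<omega> \<noteq> \<infinity>" by (intro nn_integral_PInf_AE)
  then show ?thesis using cont
  proof eventually_elim
    case (elim \<omega>)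
    define R where "R = enn2real (S \<omega>)"
    have SR: "S \<omega> = ennreal R" "R \<ge> 0" using elim(1) by (auto simp: R_def less_top)
    show ?case
    proof (rule holder_from_dyadic_increments[where A="1 + R"])
      show "continuous_on {0..T} (\<lambda>t. X t \<omega>)" using elim(2) by (rule continuous_on_subset) auto
      fix n k :: nat assume k: "k < 2 ^ n"
      \<comment> \<open>\<open>z \<le> max 1 (z ^ (2 m))\<close> turns the bound on the power into one on the increment\<close>
      define z where "z = w n * \<bar>I n k \<omega>\<bar>"
      have z: "z \<ge> 0" by (simp add: z_def w_def)
      have "ennreal (z ^ (2 * m)) = ennreal ((w n * I n k \<omega>) ^ (2 * m))"
        by (simp add: z_def power_mult_distrib power_even_abs)
      also have "\<dots> \<le> (\<Sum>k<2 ^ n. ennreal ((w n * I n k \<omega>) ^ (2 * m)))"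
        using k by (intro member_le_sum) auto
      also have "\<dots> \<le> S \<omega>"
        using sum_le_suminf[of "\<lambda>n. \<Sum>k<2 ^ n. ennreal ((w n * I n k \<omega>) ^ (2 * m))" "{n}"]
        by (simp add: S_def)
      finally have zR: "z ^ (2 * m) \<le> R" using SR by (simp add: ennreal_le_iff)
      have "z \<le> 1 + R"
      proof (cases "z \<le> 1")
        case True then show ?thesis using SR by simp
      next
        case False
        then have "z \<le> z ^ (2 * m)" using m by (intro self_le_power) auto
        then show ?thesis using zR by simp
      qed
      then have "\<bar>I n k \<omega>\<bar> \<le> (1 + R) / w n"
        unfolding z_def by (subst pos_le_divide_eq) (auto simp: w_def mult_ac)
      then show "\<bar>X (real (Suc k) * T / 2 ^ n) \<omega> - X (real k * T / 2 ^ n) \<omega>\<bar> \<le> (1 + R) * 2 powr (- \<gamma> * real n)"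
        by (simp add: I_def w_def powr_minus_divide)
    qed (use assms SR in auto)
  qed
qed

lemma hadamard_fbm_increment_moment:
  assumes B: "standard_brownian_motion M B" and "T > 0" and \<alpha>: "\<alpha> \<in> {0<..<1} \<union> {1<..<2}"
    and H: "hadamard_fbm M B \<alpha> H" and m: "m > 0"
  obtains C where "C \<ge> 0" "\<And>s t. 0 \<le> s \<Longrightarrow> s < t \<Longrightarrow> t \<le> T \<Longrightarrow>
    (\<integral>\<^sup>+\<omega>. ennreal ((H t \<omega> - H s \<omega>) ^ (2 * m)) \<partial>M) \<le> ennreal (C * (t - s) powr (min \<alpha> 1 * real m))"
proof -
  define \<kappa> where "\<kappa> = 1 / sqrt (Gamma \<alpha>)"
  let ?h = "\<lambda>t s. ln (t / s) powr ((\<alpha> - 1) / 2)"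
  have W: "\<exists>W. has_wiener_integral M B {0<..<t} (?h t) W \<and> (AE \<omega> in M. H t \<omega> = \<kappa> * W \<omega>)"
    if "t \<ge> 0" for t
  proof (cases "t = 0")
    case True
    have "has_wiener_integral M B {0<..<t} (?h t) (\<lambda>_. 0)"
      unfolding has_wiener_integral_def using True
      by (auto intro!: exI[of _ "\<lambda>_. 0::nat"] exI[of _ "\<lambda>_ _. 0::real"] simp: step_nodes_def step_fun_def step_wiener_integral_def)
    then show ?thesis using H True unfolding hadamard_fbm_def by (intro exI[of _ "\<lambda>_. 0"]) simp
  next
    case False then show ?thesis using H that unfolding hadamard_fbm_def \<kappa>_def by simp
  qed
  obtain C where C: "C > 0" and var: "\<And>s t. 0 \<le> s \<Longrightarrow> s < t \<Longrightarrow> t \<le> T \<Longrightarrow>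
    (\<integral>\<^sup>+u. ennreal ((hadamard_kernel \<alpha> t u - hadamard_kernel \<alpha> s u)\<^sup>2) \<partial>lborel) \<le> ennreal (C * (t - s) powr min \<alpha> 1)"
    using hadamard_kernel_increment[OF \<alpha> \<open>T > 0\<close>] by blast
  define D where "D = \<kappa> ^ (2 * m) * (fact (2 * m) / (2 ^ m * fact m) * (6 * C) ^ m)"
  show ?thesis
  proof (rule that[of D])
    show "D \<ge> 0" using C by (simp add: D_def)
    fix s t :: real assume st: "0 \<le> s" "s < t" "t \<le> T"
    obtain X where X: "has_wiener_integral M B {0<..<t} (?h t) X" and HX: "AE \<omega> in M. H t \<omega> = \<kappa> * X \<omega>"
      using W[of t] st by auto
    obtain Y where Y: "has_wiener_integral M B {0<..<s} (?h s) Y" and HY: "AE \<omega> in M. H s \<omega> = \<kappa> * Y \<omega>"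
      using W[of s] st by auto
    have [measurable]: "X \<in> borel_measurable M" "Y \<in> borel_measurable M"
      using X Y by (auto simp: has_wiener_integral_def)
    define V where "V = C * (t - s) powr min \<alpha> 1"
    have V: "V > 0" using C st by (simp add: V_def)
    have "(\<integral>\<^sup>+u. ennreal ((indicator {0<..<t} u * ?h t u - indicator {0<..<s} u * ?h s u)\<^sup>2) \<partial>lborel) \<le> ennreal V"
      using var[OF st] unfolding hadamard_kernel_def V_def .
    from wiener_integral_increment_moment[OF B X Y V this m]
    have XY: "(\<integral>\<^sup>+\<omega>. ennreal ((X \<omega> - Y \<omega>) ^ (2 * m)) \<partial>M) \<le> ennreal (fact (2 * m) / (2 ^ m * fact m) * (6 * V) ^ m)" .
    have "(\<integral>\<^sup>+\<omega>. ennreal ((H t \<omega> - H s \<omega>) ^ (2 * m)) \<partial>M)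
        = (\<integral>\<^sup>+\<omega>. ennreal (\<kappa> ^ (2 * m)) * ennreal ((X \<omega> - Y \<omega>) ^ (2 * m)) \<partial>M)"
    proof (rule nn_integral_cong_AE)
      show "AE \<omega> in M. ennreal ((H t \<omega> - H s \<omega>) ^ (2 * m)) = ennreal (\<kappa> ^ (2 * m)) * ennreal ((X \<omega> - Y \<omega>) ^ (2 * m))"
        using HX HY
        by eventually_elim (simp add: ennreal_mult'[symmetric] power_mult_distrib[symmetric] right_diff_distrib)
    qed
    also have "\<dots> = ennreal (\<kappa> ^ (2 * m)) * (\<integral>\<^sup>+\<omega>. ennreal ((X \<omega> - Y \<omega>) ^ (2 * m)) \<partial>M)"
      by (intro nn_integral_cmult) measurable
    also have "\<dots> \<le> ennreal (\<kappa> ^ (2 * m)) * ennreal (fact (2 * m) / (2 ^ m * fact m) * (6 * V) ^ m)"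
      by (intro mult_left_mono XY) auto
    also have "\<dots> = ennreal (\<kappa> ^ (2 * m) * (fact (2 * m) / (2 ^ m * fact m) * (6 * V) ^ m))"
      by (rule ennreal_mult'[symmetric]) simp
    also have "\<kappa> ^ (2 * m) * (fact (2 * m) / (2 ^ m * fact m) * (6 * V) ^ m) = D * ((t - s) powr min \<alpha> 1) ^ m"
      by (simp add: D_def V_def power_mult_distrib mult_ac)
    also have "((t - s) powr min \<alpha> 1) ^ m = (t - s) powr (min \<alpha> 1 * real m)"
      using st by (simp add: powr_power mult_ac)
    finally show "(\<integral>\<^sup>+\<omega>. ennreal ((H t \<omega> - H s \<omega>) ^ (2 * m)) \<partial>M) \<le> ennreal (D * (t - s) powr (min \<alpha> 1 * real m))" .
  qed
qed

text \<open>The \<open>2 m\<close>-th moment of an increment is of order \<open>\<bar>t - s\<bar> powr (a m)\<close> with \<open>a = min \<alpha> 1\<close>, so the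
  criterion gives every order below \<open>(a m - 1) / (2 m)\<close>, which tends to \<open>a / 2\<close> as \<open>m\<close> grows.\<close>

lemma hadamard_fbm_holder_paths:
  assumes B: "standard_brownian_motion M B" and "T > 0" and \<alpha>: "\<alpha> \<in> {0<..<1} \<union> {1<..<2}"
    and H: "hadamard_fbm M B \<alpha> H" and cont: "continuous_paths M H"
    and \<gamma>: "0 < \<gamma>" "\<gamma> < min \<alpha> 1 / 2"
  shows "AE \<omega> in M. holder_continuous_on {0..T} \<gamma> (\<lambda>t. H t \<omega>)"
proof -
  define a where "a = min \<alpha> 1"
  have d: "a - 2 * \<gamma> > 0" using \<gamma> by (simp add: a_def)
  \<comment> \<open>any \<open>m\<close> with \<open>m (a - 2 \<gamma>) > 1\<close>\<close>
  obtain m :: nat where m: "1 / (a - 2 * \<gamma>) < real m" using reals_Archimedean2 by blast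
  have "0 < 1 / (a - 2 * \<gamma>)" using d by simp
  then have m0: "m > 0" using m by (cases m) auto
  have "1 < real m * (a - 2 * \<gamma>)" using m d by (simp add: field_simps)
  then have r: "2 * real m * \<gamma> < a * real m - 1" by (simp add: algebra_simps)
  obtain C where C: "C \<ge> 0" and mom: "\<And>s t. 0 \<le> s \<Longrightarrow> s < t \<Longrightarrow> t \<le> T \<Longrightarrow>
    (\<integral>\<^sup>+\<omega>. ennreal ((H t \<omega> - H s \<omega>) ^ (2 * m)) \<partial>M) \<le> ennreal (C * (t - s) powr (a * real m))"
    using hadamard_fbm_increment_moment[OF B \<open>T > 0\<close> \<alpha> H m0] unfolding a_def by blast
  show ?thesis
    by (rule kolmogorov_dyadic_holder[OF \<open>T > 0\<close> C \<gamma>(1) r m0 _ mom])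
      (use H cont in \<open>auto simp: hadamard_fbm_def continuous_paths_def\<close>)
qed

text \<open>The limit of the sums over uniform partitions is a measurable function of \<open>\<omega>\<close>, and it agrees with
  the pathwise integral wherever the latter exists.\<close>

lemma measurable_rs_integral:
  assumes "a < b" "\<And>t. t \<in> {a..b} \<Longrightarrow> X t \<in> borel_measurable M"
    and ex: "AE \<omega> in M. \<exists>I. has_rs_integral f (\<lambda>t. X t \<omega>) a b I"
  shows "\<exists>I \<in> borel_measurable M. AE \<omega> in M. has_rs_integral f (\<lambda>t. X t \<omega>) a b (I \<omega>)"
proof
  let ?u = "\<lambda>n \<omega>. uniform_rs_sum f (\<lambda>t. X t \<omega>) a b n"
  have "uniform_node a b (Suc n) k \<in> {a..b}" if "k \<le> Suc n" for n k
    using tagged_partition_mono[OF tagged_partition_uniform[OF \<open>a < b\<close>], of 0 k n]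
      tagged_partition_mono[OF tagged_partition_uniform[OF \<open>a < b\<close>], of k "Suc n" n] that
      tagged_partition_uniform[OF \<open>a < b\<close>, of n] by (auto simp: tagged_partition_def)
  then have "X (uniform_node a b (Suc n) k) \<in> borel_measurable M" if "k \<le> Suc n" for n k
    using assms(2) that by blast
  then show "(\<lambda>\<omega>. lim (\<lambda>n. ?u n \<omega>)) \<in> borel_measurable M"
    unfolding uniform_rs_sum_def riemann_stieltjes_sum_def
    by (intro borel_measurable_lim_metric borel_measurable_sum borel_measurable_times borel_measurable_diff borel_measurable_const) auto
  show "AE \<omega> in M. has_rs_integral f (\<lambda>t. X t \<omega>) a b (lim (\<lambda>n. ?u n \<omega>))"
    using ex
  proof eventually_elim
    case (elim \<omega>)
    then obtain I where I: "has_rs_integral f (\<lambda>t. X t \<omega>) a b I" by blast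
    then show ?case using limI[OF rs_integral_imp_uniform_limit[OF \<open>a < b\<close> I]] by simp
  qed
qed

section \<open>Integration with respect to Hadamard fractional Brownian motion\<close>

theorem theorem7p2:
  fixes M :: "'a measure" and B H :: "real \<Rightarrow> 'a \<Rightarrow> real" and \<alpha> T :: real
  assumes "standard_brownian_motion M B"
    and "T > 0"
    and "\<alpha> \<in> {0<..<1} \<union> {1<..<2}"
    and "hadamard_fbm M B \<alpha> H"
    and "continuous_paths M H"
  shows "(\<forall>f \<beta>. holder_continuous_up_to {0..T} \<beta> f \<and>
            (\<alpha> \<in> {0<..<1} \<longrightarrow> \<beta> > 1 - \<alpha> / 2) \<and> (\<alpha> \<in> {1<..<2} \<longrightarrow> \<beta> > 1 / 2) \<longrightarrow>
            (\<exists>I \<in> borel_measurable M. AE \<omega> in M. has_rs_integral f (\<lambda>t. H t \<omega>) 0 T (I \<omega>)))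
       \<and> (\<forall>f f'. C1_on_with_deriv 0 T f f' \<longrightarrow>
            (AE \<omega> in M. has_rs_integral f (\<lambda>t. H t \<omega>) 0 T
               (f T * H T \<omega> - integral {0..T} (\<lambda>s. H s \<omega> * f' s))))"
proof (intro conjI allI impI)
  fix f :: "real \<Rightarrow> real" and \<beta> :: real
  assume A: "holder_continuous_up_to {0..T} \<beta> f \<and>
            (\<alpha> \<in> {0<..<1} \<longrightarrow> \<beta> > 1 - \<alpha> / 2) \<and> (\<alpha> \<in> {1<..<2} \<longrightarrow> \<beta> > 1 / 2)"
  define a where "a = min \<alpha> 1"
  have a: "0 < a" "a \<le> 1" "\<beta> > 1 - a / 2" using A assms(3) by (auto simp: a_def)
  \<comment> \<open>the orders of \<open>f\<close> and of the paths chosen below add up to \<open>1 + e\<close>\<close>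
  define e where "e = min ((\<beta> - (1 - a / 2)) / 4) (a / 8)"
  have "0 < e" using a by (simp add: e_def)
  moreover have "e \<le> (\<beta> - (1 - a / 2)) / 4" "e \<le> a / 8"
    unfolding e_def by (rule min.cobounded1, rule min.cobounded2)
  ultimately have e: "0 < e" "e \<le> (\<beta> - (1 - a / 2)) / 4" "e \<le> a / 8" by blast+
  have "holder_continuous_on {0..T} (1 - a / 2 + 2 * e) f"
    using A a e unfolding holder_continuous_up_to_def by auto
  moreover have "AE \<omega> in M. holder_continuous_on {0..T} (a / 2 - e) (\<lambda>t. H t \<omega>)"
    by (rule hadamard_fbm_holder_paths[OF assms(1-5)]) (use a e in \<open>auto simp: a_def\<close>)
  ultimately have "AE \<omega> in M. \<exists>I. has_rs_integral f (\<lambda>t. H t \<omega>) 0 T I"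
    using young_rs_integrable[of 0 T "1 - a / 2 + 2 * e" "a / 2 - e" f] a e assms(2) by auto
  then show "\<exists>I \<in> borel_measurable M. AE \<omega> in M. has_rs_integral f (\<lambda>t. H t \<omega>) 0 T (I \<omega>)"
    using assms(2,4) by (intro measurable_rs_integral) (auto simp: hadamard_fbm_def)
next
  fix f f' :: "real \<Rightarrow> real"
  assume C1: "C1_on_with_deriv 0 T f f'"
  have "AE \<omega> in M. H 0 \<omega> = 0" "AE \<omega> in M. continuous_on {0..} (\<lambda>t. H t \<omega>)"
    using assms(4,5) by (auto simp: hadamard_fbm_def continuous_paths_def)
  then show "AE \<omega> in M. has_rs_integral f (\<lambda>t. H t \<omega>) 0 T
               (f T * H T \<omega> - integral {0..T} (\<lambda>s. H s \<omega> * f' s))"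
  proof eventually_elim
    case (elim \<omega>)
    have "continuous_on {0..T} (\<lambda>t. H t \<omega>)" using elim(2) by (rule continuous_on_subset) auto
    from rs_integral_by_parts[OF assms(2) C1 this] elim(1) show ?case by simp
  qed
qed

end
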